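(* Let $(X,T)$ be a minimal mean equicontinuous topological dynamical system, with maximal equicontinuous factor $(X_{eq},T_{eq})$ and maximal equicontinuous factor map $\pi_{eq}:X\to X_{eq}$. Then the following are equivalent: (i) $\pi_{eq}:(X,T)\to(X_{eq},T_{eq})$ is almost 1-1; (ii) every $x\in X$ is a frequently stable point of $(X,T)$; (iii) there exists at least one frequently stable point of $(X,T)$; (iv) $\pi_{eq}:(X,T)\to(X_{eq},T_{eq})$ is almost finite to 1.
   Context: A topological dynamical system (t.d.s.) $(X,T)$ is a compact metric space $X$ (metric $d$) with a continuous map $T:X\to X$. It is minimal if every forward orbit $\{x,Tx,T^2x,\ldots\}$ is dense in $X$. It is equicontinuous if the family $\{T^n:n\in\mathbb{Z}_+\}$ is equicontinuous. A t.d.s. $(X',T')$ is a factor of $(X,T)$ if there is a continuous surjection $f:X\to X'$ (the factor map) with $f\circ T=T'\circ f$. The maximal equicontinuous factor $(X_{eq},T_{eq})$ of $(X,T)$, with factor map $\pi_{eq}$, is the (unique up to conjugacy) equicontinuous factor such that every other equicontinuous factor of $(X,T)$ is a factor of $(X_{eq},T_{eq})$. $(X,T)$ is mean equicontinuous if for every $\varepsilon>0$ there is $\delta>0$ such that $d(x,y)\le\delta$ implies $\limsup_{n\to\infty}\frac1n\sum_{i=1}^n d(T^ix,T^iy)\le\varepsilon$. For $F\subset\mathbb{Z}_+$ the upper density is $\overline{D}(F)=\limsup_{n\to\infty}\frac{\#(F\cap[0,n-1])}{n}$. $B_\delta(x)$ is the open ball of radius $\delta$ about $x$. A point $x\in X$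 is a frequently stable point of $(X,T)$ if for every $\varepsilon>0$ there is $\delta>0$ such that $\overline{D}\{i\in\mathbb{Z}_+:\operatorname{diam}(T^iB_\delta(x))>\varepsilon\}<1$. A factor map $f:X\to X'$ is almost 1-1 if $\{y\in X':\#f^{-1}(y)=1\}$ is residual in $X'$ (contains a dense $G_\delta$ set), and almost finite to 1 if $\{y\in X': f^{-1}(y)\text{ is finite}\}$ is residual in $X'$. *)

theory Defs
  imports "HOL-Analysis.Analysis"
begin

text \<open>
  A system is given by a carrier \<open>M\<close>, a metric \<open>d\<close> on \<open>M\<close> and a map \<open>T\<close>. Explicit carriers (rather than
  the class \<open>metric_space\<close>) are needed because the maximal equicontinuous factor is defined by
  quantifying over metric systems.  The space is required to be nonempty: the empty system would be
  minimal and have no frequently stable point.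
\<close>

definition tds :: "'a set \<Rightarrow> ('a \<Rightarrow> 'a \<Rightarrow> real) \<Rightarrow> ('a \<Rightarrow> 'a) \<Rightarrow> bool" where
  "tds M d T \<longleftrightarrow> Metric_space M d \<and> M \<noteq> {} \<and>
     compact_space (Metric_space.mtopology M d) \<and>
     continuous_map (Metric_space.mtopology M d) (Metric_space.mtopology M d) T"

definition minimal_tds :: "'a set \<Rightarrow> ('a \<Rightarrow> 'a \<Rightarrow> real) \<Rightarrow> ('a \<Rightarrow> 'a) \<Rightarrow> bool" where
  "minimal_tds M d T \<longleftrightarrow> tds M d T \<and>
     (\<forall>x\<in>M. Metric_space.mtopology M d closure_of (range (\<lambda>n. (T ^^ n) x)) = M)"

definition equicontinuous_tds :: "'a set \<Rightarrow> ('a \<Rightarrow> 'a \<Rightarrow> real) \<Rightarrow> ('a \<Rightarrow> 'a) \<Rightarrow> bool" where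
  "equicontinuous_tds M d T \<longleftrightarrow> tds M d T \<and>
     (\<forall>x\<in>M. \<forall>\<epsilon>>0. \<exists>\<delta>>0. \<forall>y\<in>M. d x y < \<delta> \<longrightarrow> (\<forall>n. d ((T ^^ n) x) ((T ^^ n) y) < \<epsilon>))"

definition mean_equicontinuous :: "'a set \<Rightarrow> ('a \<Rightarrow> 'a \<Rightarrow> real) \<Rightarrow> ('a \<Rightarrow> 'a) \<Rightarrow> bool" where
  "mean_equicontinuous M d T \<longleftrightarrow> tds M d T \<and>
     (\<forall>\<epsilon>>0. \<exists>\<delta>>0. \<forall>x\<in>M. \<forall>y\<in>M. d x y \<le> \<delta> \<longrightarrow>
        limsup (\<lambda>n. ereal ((1 / real n) * (\<Sum>i=1..n. d ((T ^^ i) x) ((T ^^ i) y)))) \<le> ereal \<epsilon>)"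

definition factor_map ::
    "'a set \<Rightarrow> ('a \<Rightarrow> 'a \<Rightarrow> real) \<Rightarrow> ('a \<Rightarrow> 'a) \<Rightarrow>
     'b set \<Rightarrow> ('b \<Rightarrow> 'b \<Rightarrow> real) \<Rightarrow> ('b \<Rightarrow> 'b) \<Rightarrow> ('a \<Rightarrow> 'b) \<Rightarrow> bool" where
  "factor_map M d T M' d' T' f \<longleftrightarrow> tds M d T \<and> tds M' d' T' \<and>
     continuous_map (Metric_space.mtopology M d) (Metric_space.mtopology M' d') f \<and>
     f ` M = M' \<and> (\<forall>x\<in>M. f (T x) = T' (f x))"

text \<open>
  The competing factors \<open>N\<close> are carried by subsets of the type of \<open>M\<close>, with arbitrary metrics. This is
  no restriction: a factor of \<open>M\<close> of any type can be transported isometrically to a set of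
  representatives of its fibres in \<open>M\<close>; see \<open>maximal_equicontinuous_factor_any_type\<close> below.
\<close>

definition maximal_equicontinuous_factor ::
    "'a set \<Rightarrow> ('a \<Rightarrow> 'a \<Rightarrow> real) \<Rightarrow> ('a \<Rightarrow> 'a) \<Rightarrow>
     'b set \<Rightarrow> ('b \<Rightarrow> 'b \<Rightarrow> real) \<Rightarrow> ('b \<Rightarrow> 'b) \<Rightarrow> ('a \<Rightarrow> 'b) \<Rightarrow> bool" where
  "maximal_equicontinuous_factor M d T Meq deq Teq \<pi> \<longleftrightarrow>
     equicontinuous_tds Meq deq Teq \<and> factor_map M d T Meq deq Teq \<pi> \<and>
     (\<forall>(N :: 'a set) e S. equicontinuous_tds N e S \<and> (\<exists>f. factor_map M d T N e S f) \<longrightarrow>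
        (\<exists>h. factor_map Meq deq Teq N e S h))"

definition upper_density :: "nat set \<Rightarrow> ereal" where
  "upper_density F = limsup (\<lambda>n. ereal (real (card (F \<inter> {..<n})) / real n))"

text \<open>The library constant \<open>diameter\<close>, for an explicitly given metric.\<close>

definition mdiameter :: "('a \<Rightarrow> 'a \<Rightarrow> real) \<Rightarrow> 'a set \<Rightarrow> real" where
  "mdiameter d A = (if A = {} then 0 else (SUP (x, y)\<in>A \<times> A. d x y))"

definition frequently_stable_point ::
    "'a set \<Rightarrow> ('a \<Rightarrow> 'a \<Rightarrow> real) \<Rightarrow> ('a \<Rightarrow> 'a) \<Rightarrow> 'a \<Rightarrow> bool" where
  "frequently_stable_point M d T x \<longleftrightarrow> x \<in> M \<and>
     (\<forall>\<epsilon>>0. \<exists>\<delta>>0.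
        upper_density {i. mdiameter d ((T ^^ i) ` Metric_space.mball M d x \<delta>) > \<epsilon>} < 1)"

definition residual_in :: "'a topology \<Rightarrow> 'a set \<Rightarrow> bool" where
  "residual_in X A \<longleftrightarrow> A \<subseteq> topspace X \<and>
     (\<exists>G. gdelta_in X G \<and> X closure_of G = topspace X \<and> G \<subseteq> A)"

definition almost_one_to_one ::
    "'a set \<Rightarrow> 'b set \<Rightarrow> ('b \<Rightarrow> 'b \<Rightarrow> real) \<Rightarrow> ('a \<Rightarrow> 'b) \<Rightarrow> bool" where
  "almost_one_to_one M M' d' f \<longleftrightarrow>
     residual_in (Metric_space.mtopology M' d') {y \<in> M'. card {x \<in> M. f x = y} = 1}"

definition almost_finite_to_one ::
    "'a set \<Rightarrow> 'b set \<Rightarrow> ('b \<Rightarrow> 'b \<Rightarrow> real) \<Rightarrow> ('a \<Rightarrow> 'b) \<Rightarrow> bool" where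
  "almost_finite_to_one M M' d' f \<longleftrightarrow>
     residual_in (Metric_space.mtopology M' d') {y \<in> M'. finite {x \<in> M. f x = y}}"

lemma tds_funpow_in:
  assumes "tds M d T" "x \<in> M" shows "(T ^^ n) x \<in> M"
proof (induction n)
  case (Suc n)
  have "T \<in> M \<rightarrow> M"
    using assms(1) Metric_space.topspace_mtopology[of M d]
    unfolding tds_def continuous_map_def by auto
  with Suc show ?case by auto
qed (use assms in simp)

lemma continuous_map_isometry:
  assumes "Metric_space M d" "Metric_space N e" "g ` M \<subseteq> N"
    and "\<And>x y. x \<in> M \<Longrightarrow> y \<in> M \<Longrightarrow> e (g x) (g y) = d x y"
  shows "continuous_map (Metric_space.mtopology M d) (Metric_space.mtopology N e) g"
proof -
  interpret Metric_space M d by (rule assms(1))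
  show ?thesis unfolding metric_continuous_map[OF assms(2)] using assms(3,4) by auto
qed

lemma maximal_equicontinuous_factor_any_type:
  fixes N :: "'c set" and M :: "'a set"
  assumes max: "maximal_equicontinuous_factor M d T Meq deq Teq \<pi>"
    and eq: "equicontinuous_tds N e S" and f: "factor_map M d T N e S f"
  shows "\<exists>h. factor_map Meq deq Teq N e S h"
proof -
  define g where "g = inv_into M f"
  define K where "K = g ` N"
  define e' where "e' = (\<lambda>x y. e (f x) (f y))"
  define S' where "S' = (\<lambda>x. g (S (f x)))"
  have fM: "f ` M = N" and tN: "tds N e S" using f by (auto simp: factor_map_def)
  have fg: "f (g y) = y" if "y \<in> N" for y
    using that fM unfolding g_def by (simp add: f_inv_into_f)
  have fK: "f x \<in> N" "g (f x) = x" if "x \<in> K" for x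
    using that fg unfolding K_def by auto
  have gK: "g y \<in> K" if "y \<in> N" for y using that by (simp add: K_def)
  interpret N: Metric_space N e using tN by (simp add: tds_def)
  have K: "Metric_space K e'"
  proof (rule Metric_space.intro)
    show "e' x y = 0 \<longleftrightarrow> x = y" if "x \<in> K" "y \<in> K" for x y
      using that fK N.zero unfolding e'_def by metis
  qed (auto simp: e'_def fK N.commute N.triangle)
  interpret K: Metric_space K e' by (rule K)
  have cg: "continuous_map N.mtopology K.mtopology g"
    by (rule continuous_map_isometry[OF N.Metric_space_axioms K]) (auto simp: e'_def fg gK)
  have cf: "continuous_map K.mtopology N.mtopology f"
    by (rule continuous_map_isometry[OF K N.Metric_space_axioms]) (auto simp: e'_def fK)
  have cS: "continuous_map N.mtopology N.mtopology S" using tN by (simp add: tds_def)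
  have "continuous_map K.mtopology K.mtopology (g \<circ> (S \<circ> f))"
    using cg cf cS by (meson continuous_map_compose)
  then have cS': "continuous_map K.mtopology K.mtopology S'" by (simp add: S'_def o_def)
  have "compactin K.mtopology (g ` N)"
    using image_compactin[OF _ cg] tN by (auto simp: tds_def compact_space_def)
  then have tK: "tds K e' S'"
    using cS' tN K K.topspace_mtopology unfolding tds_def compact_space_def
    by (auto simp: K_def[symmetric]) (simp add: K_def)
  have SN: "(S ^^ n) y \<in> N" if "y \<in> N" for n y using tds_funpow_in[OF tN that] .
  have S'n: "(S' ^^ n) x = g ((S ^^ n) (f x))" if "x \<in> K" for n x
  proof (induction n)
    case (Suc n) then show ?case using that fg[OF SN] fK by (simp add: S'_def)
  qed (use that fK in auto)
  have eqK: "equicontinuous_tds K e' S'"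
    unfolding equicontinuous_tds_def
  proof (intro conjI ballI allI impI)
    fix x and \<epsilon> :: real assume x: "x \<in> K" and "\<epsilon> > 0"
    then obtain \<delta> where "\<delta> > 0"
      and \<delta>: "\<And>y n. y \<in> N \<Longrightarrow> e (f x) y < \<delta> \<Longrightarrow> e ((S ^^ n) (f x)) ((S ^^ n) y) < \<epsilon>"
      using eq fK unfolding equicontinuous_tds_def by metis
    then show "\<exists>\<delta>>0. \<forall>y\<in>K. e' x y < \<delta> \<longrightarrow> (\<forall>n. e' ((S' ^^ n) x) ((S' ^^ n) y) < \<epsilon>)"
      using x fK fg SN by (intro exI[of _ \<delta>]) (auto simp: e'_def S'n)
  qed (rule tK)
  have Nf: "factor_map N e S K e' S' g"
    using tN tK cg fg by (auto simp: factor_map_def K_def S'_def)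
  have "factor_map M d T K e' S' (g \<circ> f)"
    using f Nf fM continuous_map_compose unfolding factor_map_def
    by (auto simp: image_comp[symmetric])
  then obtain h where h: "factor_map Meq deq Teq K e' S' h"
    using max eqK unfolding maximal_equicontinuous_factor_def by blast
  have S: "S y \<in> N" if "y \<in> N" for y using SN[OF that, of 1] by simp
  have "f ` K = N" using fg by (force simp: K_def)
  then have "factor_map K e' S' N e S f"
    using tN tK cf fK fg S by (auto simp: factor_map_def S'_def)
  with h have "factor_map Meq deq Teq N e S (f \<circ> h)"
    using continuous_map_compose unfolding factor_map_def
    by (auto simp: image_comp[symmetric])
  then show ?thesis by blast
qed

end

theory Submission
  imports Defs
begin

text \<open>
  Let \<open>D x y\<close> be the upper mean distance of the orbits of \<open>x\<close> and \<open>y\<close>. Mean equicontinuity makes \<open>D\<close> a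
  continuous pseudometric for which \<open>T\<close> is an isometry, and since an endomorphism of a minimal isometric
  system is an isometry, the fibres of the maximal equicontinuous factor are exactly the \<open>D\<close>-classes.
  If arbitrarily small fibres exist, then by minimality the points with fibre of diameter less than \<open>c\<close>
  form a dense open set for every \<open>c\<close>, and Baire's theorem gives almost 1-1. A finite fibre is contracted
  by suitable \<open>T\<^sup>i\<close>, since its points have mean distance 0.

  If \<open>x\<close> is frequently stable, a ball \<open>B\<close> around \<open>x\<close> meets every \<open>D\<close>-class that meets some \<open>D\<close>-ball \<open>W\<close>.
  Choose \<open>G\<close> such that every orbit segment of length \<open>G\<close> is dense up to a small error, and replace each
  of the points \<open>z, T z, ..., T\<^sup>G\<^sup>-\<^sup>1 z\<close> lying in \<open>W\<close> by a point of \<open>B\<close> in its class. For times \<open>i\<close> of full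
  density, \<open>T\<^sup>i\<close> moves the finitely many replaced points close to their replacements; if moreover \<open>T\<^sup>i B\<close>
  is small, then the \<open>T\<^sup>i\<close>-image of the fibre at the centre of \<open>W\<close>, every point of which is nearly hit by
  the segment, is small too.
\<close>

section \<open>Uniform continuity on compact spaces; density of sets with gaps\<close>

text \<open>Heine-Cantor: continuity on a complete space gives Cauchy continuity, which is uniform
  on a totally bounded space.\<close>

lemma continuous_on_compact_uniform:
  assumes "Metric_space M d" "Metric_space M' d'"
    and comp: "compact_space (Metric_space.mtopology M d)"
    and cont: "continuous_map (Metric_space.mtopology M d) (Metric_space.mtopology M' d') f"
    and "\<epsilon> > 0"
  obtains \<delta> where "\<delta> > 0" "\<And>x y. x \<in> M \<Longrightarrow> y \<in> M \<Longrightarrow> d x y < \<delta> \<Longrightarrow> d' (f x) (f y) < \<epsilon>"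
proof -
  interpret A: Metric_space M d by fact
  interpret B: Metric_space M' d' by fact
  have "uniformly_continuous_map (metric (M,d)) (metric (M',d')) f"
  proof (rule Cauchy_imp_uniformly_continuous_map)
    show "Cauchy_continuous_map (metric (M,d)) (metric (M',d')) f"
      by (rule continuous_imp_Cauchy_continuous_map)
        (use cont comp A.compact_space_imp_mcomplete in \<open>auto simp: mtopology_of_def\<close>)
    show "Metric_space.mtotally_bounded (mspace (metric (M,d))) (mdist (metric (M,d))) (mspace (metric (M,d)))"
      using comp A.compact_space_eq_mcomplete_mtotally_bounded by simp
  qed
  then obtain \<delta> where "\<delta> > 0" "\<And>x y. x \<in> M \<Longrightarrow> y \<in> M \<Longrightarrow> d y x < \<delta> \<Longrightarrow> d' (f y) (f x) < \<epsilon>"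
    using \<open>\<epsilon> > 0\<close> unfolding uniformly_continuous_map_def by force
  then show thesis by (intro that) auto
qed

text \<open>Each of the consecutive blocks of length \<open>G\<close> contains a time outside
  \<open>F\<close>, so the upper density is at most \<open>1 - 1 / G\<close>.\<close>

lemma upper_density_less_1_if_gaps:
  assumes gap: "\<And>n. \<exists>k<G. n + k \<notin> F"
  shows "upper_density F < 1"
proof -
  have "G > 0" using gap[of 0] by auto
  have block: "card (F \<inter> {..<q * G}) \<le> q * (G - 1)" for q
  proof (induction q)
    case (Suc q)
    obtain k where k: "k < G" "q * G + k \<notin> F" using gap by blast
    have "F \<inter> {..<Suc q * G} \<subseteq> (F \<inter> {..<q * G}) \<union> ({q * G..<q * G + G} - {q * G + k})"
      using k(2) by auto
    then have "card (F \<inter> {..<Suc q * G}) \<le> card ((F \<inter> {..<q * G}) \<union> ({q * G..<q * G + G} - {q * G + k}))"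
      by (intro card_mono) auto
    also have "\<dots> \<le> card (F \<inter> {..<q * G}) + card ({q * G..<q * G + G} - {q * G + k})"
      by (rule card_Un_le)
    also have "card ({q * G..<q * G + G} - {q * G + k}) = G - 1"
      using k(1) by (subst card_Diff_singleton) auto
    finally show ?case using Suc by simp
  qed simp
  define c where "c = 1 - 1 / real G"
  have le: "real (card (F \<inter> {..<n})) / real n \<le> c + real G / real n" if "n > 0" for n
  proof -
    \<comment> \<open>Rounding \<open>n\<close> up to a whole number of blocks costs at most
      \<open>G / n\<close>, which vanishes in the limit.\<close>
    let ?q = "n div G"
    have "n < Suc ?q * G" using \<open>G > 0\<close> by (simp add: dividend_less_times_div mult.commute add.commute)
    then have "card (F \<inter> {..<n}) \<le> card (F \<inter> {..<Suc ?q * G})" by (intro card_mono) auto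
    also have "\<dots> \<le> Suc ?q * (G - 1)" by (rule block)
    finally have "real (card (F \<inter> {..<n})) \<le> real (Suc ?q * (G - 1))"
      by (simp only: of_nat_le_iff)
    also have "\<dots> = real (Suc ?q) * real (G - 1)" by (rule of_nat_mult)
    also have "\<dots> = (real ?q + 1) * (real G - 1)"
      using \<open>G > 0\<close> by (simp add: of_nat_diff add.commute)
    also have "\<dots> \<le> (real n / real G + 1) * (real G - 1)"
      using \<open>G > 0\<close> of_nat_div_le_of_nat[of n G, where 'a=real] by (intro mult_right_mono) auto
    also have "\<dots> \<le> c * real n + real G"
      using \<open>G > 0\<close> by (simp add: c_def field_simps)
    finally show ?thesis using that by (simp add: field_simps)
  qed
  have "(\<lambda>n. c + real G / real n) \<longlonglongrightarrow> c + 0"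
    by (intro tendsto_add tendsto_const lim_const_over_n)
  then have "(\<lambda>n. ereal (c + real G / real n)) \<longlonglongrightarrow> ereal c" by simp
  then have "limsup (\<lambda>n. ereal (c + real G / real n)) = ereal c" by (rule lim_imp_Limsup[rotated]) simp
  moreover have "upper_density F \<le> limsup (\<lambda>n. ereal (c + real G / real n))"
    unfolding upper_density_def
    by (intro Limsup_mono eventually_mono[OF eventually_gt_at_top[of 0]]) (use le in simp)
  moreover have "c < 1" using \<open>G > 0\<close> by (simp add: c_def)
  ultimately show ?thesis by (metis ereal_less(3) order_le_less_trans)
qed

section \<open>Compactness and minimality: subsequences, surjectivity, uniform hitting times\<close>

locale minimal_mean_equicontinuous = Metric_space M d
  for M :: "'a set" and d :: "'a \<Rightarrow> 'a \<Rightarrow> real" +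
  fixes T :: "'a \<Rightarrow> 'a"
  assumes minimal: "minimal_tds M d T" and mean_eq: "mean_equicontinuous M d T"
begin

lemma tds: "tds M d T"
  using minimal by (simp add: minimal_tds_def)

lemma compact: "compact_space mtopology"
  and cont: "continuous_map mtopology mtopology T"
  and nonempty: "M \<noteq> {}"
  using tds by (auto simp: tds_def)

lemma funpow_in [simp]: "x \<in> M \<Longrightarrow> (T ^^ n) x \<in> M"
  using tds_funpow_in[OF tds] .

lemma T_in [simp]: "x \<in> M \<Longrightarrow> T x \<in> M"
  using funpow_in[of x 1] by simp

lemma cont_funpow: "continuous_map mtopology mtopology (T ^^ n)"
proof (induction n)
  case (Suc n)
  then show ?case using continuous_map_compose[OF _ cont] by (simp add: o_def)
qed (simp add: id_def)

lemma uniform_funpow: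
  assumes "\<epsilon> > 0"
  obtains \<delta> where "\<delta> > 0"
    "\<And>x y. x \<in> M \<Longrightarrow> y \<in> M \<Longrightarrow> d x y < \<delta> \<Longrightarrow> d ((T ^^ n) x) ((T ^^ n) y) < \<epsilon>"
  using continuous_on_compact_uniform[OF Metric_space_axioms Metric_space_axioms compact cont_funpow assms]
  by metis

lemma uniform_funpow_less:
  assumes "\<epsilon> > 0"
  obtains \<delta> where "\<delta> > 0"
    "\<And>k x y. k < G \<Longrightarrow> x \<in> M \<Longrightarrow> y \<in> M \<Longrightarrow> d x y < \<delta> \<Longrightarrow> d ((T ^^ k) x) ((T ^^ k) y) < \<epsilon>"
proof -
  have "\<exists>\<delta>>0. \<forall>k<G. \<forall>x\<in>M. \<forall>y\<in>M. d x y < \<delta> \<longrightarrow> d ((T ^^ k) x) ((T ^^ k) y) < \<epsilon>"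
  proof (induction G)
    case (Suc G)
    then obtain \<delta> where \<delta>: "\<delta> > 0"
      "\<forall>k<G. \<forall>x\<in>M. \<forall>y\<in>M. d x y < \<delta> \<longrightarrow> d ((T ^^ k) x) ((T ^^ k) y) < \<epsilon>" by blast
    obtain \<delta>' where "\<delta>' > 0"
      "\<And>x y. x \<in> M \<Longrightarrow> y \<in> M \<Longrightarrow> d x y < \<delta>' \<Longrightarrow> d ((T ^^ G) x) ((T ^^ G) y) < \<epsilon>"
      using uniform_funpow[OF assms] by metis
    with \<delta> show ?case by (intro exI[of _ "min \<delta> \<delta>'"]) (auto simp: less_Suc_eq)
  qed (auto intro: exI[of _ 1])
  then show thesis using that by blast
qed

lemma bounded_d:
  obtains K where "K > 0" "\<And>x y. x \<in> M \<Longrightarrow> y \<in> M \<Longrightarrow> d x y \<le> K"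
proof -
  have "mbounded M"
    using compact compactin_imp_mbounded by (simp add: compact_space_def)
  then show thesis using that by (auto simp: mbounded_alt_pos)
qed

lemma convergent_subseq:
  assumes "\<And>n::nat. \<sigma> n \<in> M"
  obtains l r where "l \<in> M" "strict_mono r" "(\<lambda>n. d (\<sigma> (r n)) l) \<longlonglongrightarrow> 0"
proof -
  have "range \<sigma> \<subseteq> M" using assms by auto
  then obtain l r where "l \<in> M" "strict_mono r" "limitin mtopology (\<sigma> \<circ> r) l sequentially"
    using compact unfolding compact_space_sequentially by blast
  then show thesis using that by (auto simp: limitin_metric_dist_null o_def)
qed

lemma orbit_dense:
  assumes "x \<in> M" "y \<in> M" "r > 0"
  obtains n where "d ((T ^^ n) x) y < r"
proof -
  have "y \<in> mtopology closure_of (range (\<lambda>n. (T ^^ n) x))"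
    using minimal assms unfolding minimal_tds_def by blast
  then show thesis
    using that assms unfolding metric_closure_of by (auto simp: commute)
qed

lemma funpow_funpow: "(T ^^ m) ((T ^^ n) x) = (T ^^ (m + n)) x"
  by (simp add: funpow_add)

text \<open>The orbit of \<open>T x0\<close> is dense, so some points
  \<open>T ((T ^^ m n) x0)\<close> approach \<open>y\<close>; a limit point of the
  \<open>(T ^^ m n) x0\<close> is sent to \<open>y\<close> by continuity.\<close>

lemma surj:
  assumes "y \<in> M"
  obtains x where "x \<in> M" "T x = y"
proof -
  obtain x0 where x0: "x0 \<in> M" using nonempty by blast
  have "\<exists>m. d ((T ^^ m) (T x0)) y < 1 / real (Suc n)" for n
    using orbit_dense[of "T x0" y "1 / real (Suc n)"] x0 assms by auto
  then obtain m where m: "\<And>n. d ((T ^^ m n) (T x0)) y < 1 / real (Suc n)" by metis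
  obtain l r where l: "l \<in> M" "strict_mono r" "(\<lambda>n. d ((T ^^ m (r n)) x0) l) \<longlonglongrightarrow> 0"
    using convergent_subseq[of "\<lambda>n. (T ^^ m n) x0"] x0 by auto
  have "d (T l) y \<le> 0"
  proof (rule field_le_epsilon)
    fix e :: real assume "e > 0"
    then obtain \<delta> where \<delta>: "\<delta> > 0" "\<And>x y. x \<in> M \<Longrightarrow> y \<in> M \<Longrightarrow> d x y < \<delta> \<Longrightarrow> d (T x) (T y) < e/2"
      using uniform_funpow[of "e/2" 1] by auto
    have "\<forall>\<^sub>F n in sequentially. d ((T ^^ m (r n)) x0) l < \<delta>"
      using order_tendstoD(2)[OF l(3) \<delta>(1)] .
    moreover have "\<forall>\<^sub>F n in sequentially. 1 / real (Suc n) < e/2"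
      using order_tendstoD(2)[OF LIMSEQ_inverse_real_of_nat, of "e/2"] \<open>e > 0\<close>
      by (simp add: inverse_eq_divide)
    ultimately obtain n where n: "d ((T ^^ m (r n)) x0) l < \<delta>" "1 / real (Suc n) < e/2"
      using eventually_happens[OF eventually_conj] by fastforce
    have "1 / real (Suc (r n)) \<le> 1 / real (Suc n)"
      using seq_suble[OF l(2), of n] by (simp add: frac_le)
    with n m[of "r n"] have "d ((T ^^ m (r n)) (T x0)) y < e/2" by linarith
    moreover have "d (T ((T ^^ m (r n)) x0)) (T l) < e/2"
      using \<delta>(2) n(1) x0 l(1) by auto
    ultimately show "d (T l) y \<le> 0 + e"
      using triangle[of "T l" "T ((T ^^ m (r n)) x0)" y] x0 l(1) assms
      by (auto simp: funpow_swap1 commute)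
  qed
  then show thesis using that[of l] l(1) assms by (metis T_in mdist_pos_less not_le)
qed

lemma surj_funpow:
  assumes "y \<in> M"
  obtains x where "x \<in> M" "(T ^^ n) x = y"
proof -
  have "\<exists>x\<in>M. (T ^^ n) x = y"
    using assms
  proof (induction n arbitrary: y)
    case (Suc n)
    obtain z where "z \<in> M" "T z = y" using surj[OF Suc.prems] .
    with Suc.IH[of z] show ?case by auto
  qed auto
  then show thesis using that by blast
qed

lemma finite_net:
  assumes "r > 0"
  obtains C where "finite C" "C \<subseteq> M" "\<And>x. x \<in> M \<Longrightarrow> \<exists>c\<in>C. d c x < r"
proof -
  have "mtotally_bounded M"
    using compact compact_space_eq_mcomplete_mtotally_bounded by simp
  then obtain C where "finite C" "C \<subseteq> M" "M \<subseteq> (\<Union>x\<in>C. mball x r)"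
    using assms by (auto simp: mtotally_bounded_def)
  then have "\<exists>c\<in>C. d c x < r" if "x \<in> M" for x
    using that by (fastforce dest: subsetD)
  then show thesis using that \<open>finite C\<close> \<open>C \<subseteq> M\<close> by blast
qed

text \<open>For one target \<open>c\<close>, points avoiding it for ever longer times would
  accumulate at some \<open>l\<close>, whose orbit does come close to \<open>c\<close>; continuity
  transfers this to nearby points. A finite net of targets makes the bound independent of
  \<open>c\<close>.\<close>

lemma syndetic:
  assumes "r > 0"
  obtains G where "\<And>z c. z \<in> M \<Longrightarrow> c \<in> M \<Longrightarrow> \<exists>n<G. d ((T ^^ n) z) c < r"
proof -
  have *: "\<exists>G. \<forall>z\<in>M. \<exists>n<G. d ((T ^^ n) z) c < r / 2" if c: "c \<in> M" for c
  proof (rule ccontr)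
    assume "\<not> ?thesis"
    then have "\<forall>G. \<exists>z. z \<in> M \<and> (\<forall>n<G. d ((T ^^ n) z) c \<ge> r / 2)" by (meson not_less)
    then obtain z where z: "\<And>G. z G \<in> M" "\<And>G n. n < G \<Longrightarrow> d ((T ^^ n) (z G)) c \<ge> r / 2" by metis
    obtain l s where l: "l \<in> M" "strict_mono s" "(\<lambda>n. d (z (s n)) l) \<longlonglongrightarrow> 0"
      using convergent_subseq[of z] z(1) by blast
    obtain n where n: "d ((T ^^ n) l) c < r / 4" using orbit_dense[OF l(1) c, of "r/4"] assms by auto
    obtain \<delta> where \<delta>: "\<delta> > 0" "\<And>x y. x \<in> M \<Longrightarrow> y \<in> M \<Longrightarrow> d x y < \<delta> \<Longrightarrow> d ((T ^^ n) x) ((T ^^ n) y) < r/4"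
      using uniform_funpow[of "r/4" n] assms by auto
    have "\<forall>\<^sub>F k in sequentially. d (z (s k)) l < \<delta>"
      using order_tendstoD(2)[OF l(3) \<delta>(1)] .
    then obtain k where k: "d (z (s k)) l < \<delta>" "k > n"
      using eventually_happens[OF eventually_conj[OF _ eventually_gt_at_top[of n]]] by fastforce
    \<comment> \<open>Since \<open>s k >= k > n\<close>, the point \<open>z (s k)\<close> was chosen
      to avoid \<open>c\<close> at time \<open>n\<close>.\<close>
    have "n < s k" using seq_suble[OF l(2), of k] k(2) by linarith
    then have "d ((T ^^ n) (z (s k))) c \<ge> r / 2" by (rule z(2))
    moreover have "d ((T ^^ n) (z (s k))) ((T ^^ n) l) < r/4" using \<delta>(2) k(1) z(1) l(1) by blast
    ultimately show False
      using n triangle[of "(T ^^ n) (z (s k))" "(T ^^ n) l" c] z(1) l(1) c by auto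
  qed
  then obtain g where g: "\<And>c z. c \<in> M \<Longrightarrow> z \<in> M \<Longrightarrow> \<exists>n<g c. d ((T ^^ n) z) c < r / 2" by metis
  obtain C where C: "finite C" "C \<subseteq> M" "\<And>x. x \<in> M \<Longrightarrow> \<exists>c\<in>C. d c x < r / 2"
    using finite_net[of "r / 2"] assms by auto
  \<comment> \<open>The witness is the sum of the bounds over the net, which dominates each of
    them.\<close>
  show thesis
  proof (rule that)
    fix z c assume "z \<in> M" "c \<in> M"
    then obtain c' where c': "c' \<in> C" "d c' c < r / 2" using C(3) by blast
    then obtain n where "n < g c'" "d ((T ^^ n) z) c' < r / 2" using g C(2) \<open>z \<in> M\<close> by blast
    moreover have "g c' \<le> (\<Sum>c\<in>C. g c)" using C(1) c'(1) by (simp add: member_le_sum)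
    ultimately show "\<exists>n<(\<Sum>c\<in>C. g c). d ((T ^^ n) z) c < r"
      using c' C(2) \<open>z \<in> M\<close> \<open>c \<in> M\<close> triangle[of "(T ^^ n) z" c' c]
      by (intro exI[of _ n]) auto
  qed
qed

section \<open>The mean pseudometric \<open>D\<close> and its invariance under
  \<open>T\<close>\<close>

definition avg :: "nat \<Rightarrow> 'a \<Rightarrow> 'a \<Rightarrow> real" where
  "avg n x y = (1 / real n) * (\<Sum>i=1..n. d ((T ^^ i) x) ((T ^^ i) y))"

text \<open>The upper limit is finite on \<open>M\<close> because \<open>d\<close> is bounded there
  (\<open>limsup_avg\<close>), so the conversion to a real loses nothing.\<close>

definition D :: "'a \<Rightarrow> 'a \<Rightarrow> real" where
  "D x y = real_of_ereal (limsup (\<lambda>n. ereal (avg n x y)))"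

lemma avg_nonneg: "0 \<le> avg n x y"
  by (simp add: avg_def sum_nonneg)

lemma avg_commute: "avg n x y = avg n y x"
  by (simp add: avg_def commute)

lemma avg_triangle:
  "x \<in> M \<Longrightarrow> y \<in> M \<Longrightarrow> z \<in> M \<Longrightarrow> avg n x z \<le> avg n x y + avg n y z"
  unfolding avg_def distrib_left[symmetric] sum.distrib[symmetric]
  by (intro mult_left_mono sum_mono triangle) auto

lemma limsup_avg:
  assumes "x \<in> M" "y \<in> M"
  shows "limsup (\<lambda>n. ereal (avg n x y)) = ereal (D x y)"
proof -
  obtain K where K: "K > 0" "\<And>x y. x \<in> M \<Longrightarrow> y \<in> M \<Longrightarrow> d x y \<le> K" by (rule bounded_d) blast
  have "avg n x y \<le> K" for n
  proof (cases "n = 0")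
    case False
    have "(\<Sum>i=1..n. d ((T ^^ i) x) ((T ^^ i) y)) \<le> (\<Sum>i=1..n. K)"
      by (intro sum_mono K) (use assms in auto)
    with False show ?thesis by (simp add: avg_def field_simps)
  qed (use K in \<open>simp add: avg_def\<close>)
  then have "limsup (\<lambda>n. ereal (avg n x y)) \<le> ereal K" by (intro Limsup_bounded) auto
  moreover have "0 \<le> limsup (\<lambda>n. ereal (avg n x y))"
    by (rule le_Limsup) (auto simp: avg_nonneg)
  ultimately show ?thesis
    unfolding D_def by (subst ereal_real) auto
qed

text \<open>Serves the triangle inequality and the invariance of \<open>D\<close>: eventual bounds
  on averages can be combined at each large \<open>n\<close>.\<close>

lemma D_le_iff:
  assumes "x \<in> M" "y \<in> M"
  shows "D x y \<le> e \<longleftrightarrow> (\<forall>e'>e. \<forall>\<^sub>F n in sequentially. avg n x y < e')"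
proof -
  have "D x y \<le> e \<longleftrightarrow> limsup (\<lambda>n. ereal (avg n x y)) \<le> ereal e"
    using limsup_avg[OF assms] by simp
  also have "\<dots> \<longleftrightarrow> (\<forall>e'>e. \<forall>\<^sub>F n in sequentially. avg n x y < e')"
    unfolding Limsup_le_iff
  proof safe
    fix c assume *: "\<forall>e'>e. \<forall>\<^sub>F n in sequentially. avg n x y < e'" "ereal e < c"
    then show "\<forall>\<^sub>F n in sequentially. ereal (avg n x y) < c"
      by (cases c) auto
  next
    fix e' assume *: "\<forall>w>ereal e. \<forall>\<^sub>F n in sequentially. ereal (avg n x y) < w" "e < e'"
    have "\<forall>\<^sub>F n in sequentially. ereal (avg n x y) < ereal e'"
      using *(1)[rule_format, of "ereal e'"] *(2) by simp
    then show "\<forall>\<^sub>F n in sequentially. avg n x y < e'" by simp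
  qed
  finally show ?thesis .
qed

lemma avg_less:
  assumes "x \<in> M" "y \<in> M" "D x y < e"
  shows "\<forall>\<^sub>F n in sequentially. avg n x y < e"
  using assms D_le_iff[of x y "D x y"] by auto

lemma D_nonneg [simp]: "0 \<le> D x y"
proof -
  have "0 \<le> limsup (\<lambda>n. ereal (avg n x y))"
    by (rule le_Limsup) (auto simp: avg_nonneg)
  then show ?thesis by (simp add: D_def real_of_ereal_pos)
qed

lemma D_commute: "D x y = D y x"
  by (simp add: D_def avg_commute)

lemma D_triangle:
  assumes "x \<in> M" "y \<in> M" "z \<in> M"
  shows "D x z \<le> D x y + D y z"
  unfolding D_le_iff[OF assms(1,3)]
proof (intro allI impI)
  fix e' assume "e' > D x y + D y z"
  \<comment> \<open>The slack \<open>e' - D x y - D y z\<close> is split evenly between the two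
    averages.\<close>
  then have "D x y < D x y + (e' - D x y - D y z) / 2" "D y z < D y z + (e' - D x y - D y z) / 2" by auto
  then have "\<forall>\<^sub>F n in sequentially. avg n x y < D x y + (e' - D x y - D y z) / 2"
     "\<forall>\<^sub>F n in sequentially. avg n y z < D y z + (e' - D x y - D y z) / 2"
    using assms avg_less by blast+
  then show "\<forall>\<^sub>F n in sequentially. avg n x z < e'"
  proof eventually_elim
    case (elim n)
    then show ?case using avg_triangle[OF assms, of n] by argo
  qed
qed

lemma D_refl [simp]: "x \<in> M \<Longrightarrow> D x x = 0"
  by (simp add: D_def avg_def zero_ereal_def[symmetric] Limsup_const)

text \<open>Moving both points one step along their orbits shifts the sum, so in the difference only
  two boundary terms survive. For \<open>n = 0\<close> both sides are 0, because division by zero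
  gives 0.\<close>

lemma avg_T: 
  assumes "x \<in> M" "y \<in> M" "\<forall>x\<in>M. \<forall>y\<in>M. d x y \<le> K"
  shows "\<bar>avg n (T x) (T y) - avg n x y\<bar> \<le> K / real n"
proof (cases "n = 0")
  case False
  let ?f = "\<lambda>i. d ((T ^^ i) x) ((T ^^ i) y)"
  have "avg n (T x) (T y) = (1 / real n) * (\<Sum>i=1..n. ?f (Suc i))"
    by (simp add: avg_def funpow_swap1)
  also have "(\<Sum>i=1..n. ?f (Suc i)) = (\<Sum>i=1..n. ?f i) + ?f (Suc n) - ?f 1"
    using sum_telescope''[of 1 "Suc n" ?f] False sum_subtractf[of "\<lambda>i. ?f (Suc i)" ?f "{1..n}"]
      sum_Suc_diff[of 1 "n" ?f] by simp
  finally have "avg n (T x) (T y) - avg n x y =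
      (1 / real n) * ((\<Sum>i=1..n. ?f i) + ?f (Suc n) - ?f 1) - (1 / real n) * (\<Sum>i=1..n. ?f i)"
    by (simp only: avg_def)
  also have "\<dots> = (?f (Suc n) - ?f 1) / real n"
    unfolding right_diff_distrib[symmetric] by simp
  finally have "avg n (T x) (T y) - avg n x y = (?f (Suc n) - ?f 1) / real n" .
  moreover have "\<bar>?f (Suc n) - ?f 1\<bar> \<le> K"
    using bspec[OF bspec[OF assms(3)], of "(T ^^ Suc n) x" "(T ^^ Suc n) y"]
      bspec[OF bspec[OF assms(3)], of "(T ^^ 1) x" "(T ^^ 1) y"] assms(1,2)
      nonneg[of "(T ^^ Suc n) x" "(T ^^ Suc n) y"] nonneg[of "(T ^^ 1) x" "(T ^^ 1) y"] 
    unfolding abs_le_iff by (simp del: nonneg)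
  ultimately show ?thesis by (simp add: abs_divide divide_right_mono)
qed (simp add: avg_def)

text \<open>The boundary error \<open>K / n\<close> from \<open>avg_T\<close> vanishes in the limit;
  half of the slack is reserved for it in either direction.\<close>

lemma D_T:
  assumes "x \<in> M" "y \<in> M"
  shows "D (T x) (T y) = D x y"
proof -
  obtain K where K: "K > 0" "\<forall>x\<in>M. \<forall>y\<in>M. d x y \<le> K" by (rule bounded_d) blast
  have small: "\<forall>\<^sub>F n in sequentially. K / real n < e" if "e > 0" for e
    using order_tendstoD(2)[OF lim_const_over_n that] .
  show ?thesis
  proof (rule antisym)
    show "D (T x) (T y) \<le> D x y"
      unfolding D_le_iff[OF T_in[OF assms(1)] T_in[OF assms(2)]]
    proof (intro allI impI)
      fix e' assume *: "D x y < e'"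
      then have "\<forall>\<^sub>F n in sequentially. avg n x y < (D x y + e') / 2" using assms by (intro avg_less) auto
      moreover have "\<forall>\<^sub>F n in sequentially. K / real n < (e' - D x y) / 2" using * by (intro small) auto
      ultimately show "\<forall>\<^sub>F n in sequentially. avg n (T x) (T y) < e'"
      proof eventually_elim
        case (elim n)
        then show ?case using avg_T[OF assms K(2), of n] by argo
      qed
    qed
    show "D x y \<le> D (T x) (T y)"
      unfolding D_le_iff[OF assms]
    proof (intro allI impI)
      fix e' assume *: "D (T x) (T y) < e'"
      then have "\<forall>\<^sub>F n in sequentially. avg n (T x) (T y) < (D (T x) (T y) + e') / 2"
        using assms by (intro avg_less) auto
      moreover have "\<forall>\<^sub>F n in sequentially. K / real n < (e' - D (T x) (T y)) / 2" using * by (intro small) auto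
      ultimately show "\<forall>\<^sub>F n in sequentially. avg n x y < e'"
      proof eventually_elim
        case (elim n)
        then show ?case using avg_T[OF assms K(2), of n] by argo
      qed
    qed
  qed
qed

lemma D_funpow: "x \<in> M \<Longrightarrow> y \<in> M \<Longrightarrow> D ((T ^^ n) x) ((T ^^ n) y) = D x y"
  by (induction n) (simp_all add: D_T)

text \<open>Mean equicontinuity at \<open>\<epsilon> / 2\<close>; halving turns its weak inequality
  into a strict one. All later continuity of \<open>D\<close> comes from here.\<close>

lemma D_small:
  assumes "\<epsilon> > 0"
  obtains \<delta> where "\<delta> > 0" "\<And>x y. x \<in> M \<Longrightarrow> y \<in> M \<Longrightarrow> d x y < \<delta> \<Longrightarrow> D x y < \<epsilon>"
proof -
  have "\<epsilon> / 2 > 0" using assms by simp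
  then obtain \<delta> where "\<delta> > 0" and \<delta>: "\<And>x y. x \<in> M \<Longrightarrow> y \<in> M \<Longrightarrow> d x y \<le> \<delta> \<Longrightarrow>
      limsup (\<lambda>n. ereal (avg n x y)) \<le> ereal (\<epsilon> / 2)"
    using mean_eq unfolding mean_equicontinuous_def avg_def by blast
  then have "D x y < \<epsilon>" if "x \<in> M" "y \<in> M" "d x y < \<delta>" for x y
    using \<delta>[of x y] limsup_avg[of x y] that assms by simp
  with \<open>\<delta> > 0\<close> show thesis using that by blast
qed

lemma D_tendsto:
  assumes "\<And>n. \<sigma> n \<in> M" "l \<in> M" "(\<lambda>n. d (\<sigma> n) l) \<longlonglongrightarrow> 0"
  shows "(\<lambda>n. D (\<sigma> n) l) \<longlonglongrightarrow> 0"
proof (rule order_tendstoI)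
  fix a :: real assume "a > 0"
  then obtain \<delta> where \<delta>: "\<delta> > 0" "\<And>x y. x \<in> M \<Longrightarrow> y \<in> M \<Longrightarrow> d x y < \<delta> \<Longrightarrow> D x y < a"
    using D_small by blast
  have "\<forall>\<^sub>F n in sequentially. d (\<sigma> n) l < \<delta>" using order_tendstoD(2)[OF assms(3) \<delta>(1)] .
  then show "\<forall>\<^sub>F n in sequentially. D (\<sigma> n) l < a"
    by eventually_elim (use \<delta> assms in auto)
next
  fix a :: real assume "a < 0"
  then show "\<forall>\<^sub>F n in sequentially. a < D (\<sigma> n) l"
    using D_nonneg by (intro always_eventually allI) (rule order_less_le_trans)
qed

section \<open>Pairs at mean distance 0 and their contraction\<close>

text \<open>Upper density counts times \<open>i < n\<close>, whereas \<open>avg\<close> sums over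
  \<open>1..n\<close>; the change costs at most the time 0 term \<open>d x y / n\<close>.\<close>

lemma D_zero_avg:
  assumes "x \<in> M" "y \<in> M" "D x y = 0"
  shows "(\<lambda>n. (1 / real n) * (\<Sum>i<n. d ((T ^^ i) x) ((T ^^ i) y))) \<longlonglongrightarrow> 0"
proof (rule tendsto_sandwich[of "\<lambda>_. 0" _ _ "\<lambda>n. d x y / real n + avg n x y"])
  have "(\<lambda>n. avg n x y) \<longlonglongrightarrow> 0"
  proof (rule order_tendstoI)
    fix a :: real assume "a < 0"
    then show "\<forall>\<^sub>F n in sequentially. a < avg n x y"
      using avg_nonneg by (intro always_eventually allI) (rule order_less_le_trans)
  qed (use avg_less[OF assms(1,2)] assms(3) in simp)
  from tendsto_add[OF lim_const_over_n[of "d x y"] this]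
  show "(\<lambda>n. d x y / real n + avg n x y) \<longlonglongrightarrow> 0" by simp
  show "\<forall>\<^sub>F n in sequentially. (1 / real n) * (\<Sum>i<n. d ((T ^^ i) x) ((T ^^ i) y)) \<le> d x y / real n + avg n x y"
  proof (intro always_eventually allI)
    fix n
    have "(\<Sum>i<n. d ((T ^^ i) x) ((T ^^ i) y)) \<le> (\<Sum>i\<in>insert 0 {1..n}. d ((T ^^ i) x) ((T ^^ i) y))"
      by (intro sum_mono2) (auto simp: nonneg)
    also have "\<dots> = d x y + (\<Sum>i=1..n. d ((T ^^ i) x) ((T ^^ i) y))" by (subst sum.insert) auto
    finally show "(1 / real n) * (\<Sum>i<n. d ((T ^^ i) x) ((T ^^ i) y)) \<le> d x y / real n + avg n x y"
      unfolding avg_def by (cases "n = 0") (auto simp: field_simps)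
  qed
qed (auto intro!: always_eventually sum_nonneg divide_nonneg_nonneg)

lemma D_zero_avg_sum:
  assumes "finite I" "\<And>p. p \<in> I \<Longrightarrow> u p \<in> M \<and> v p \<in> M \<and> D (u p) (v p) = 0" "\<epsilon> > 0"
  shows "\<forall>\<^sub>F n in sequentially. (\<Sum>i<n. \<Sum>p\<in>I. d ((T ^^ i) (u p)) ((T ^^ i) (v p))) < \<epsilon> * real n"
proof -
  have "(\<lambda>n. \<Sum>p\<in>I. (1 / real n) * (\<Sum>i<n. d ((T ^^ i) (u p)) ((T ^^ i) (v p)))) \<longlonglongrightarrow> (\<Sum>p\<in>I. 0)"
    using assms(2) by (intro tendsto_sum D_zero_avg) auto
  then have "\<forall>\<^sub>F n in sequentially. (\<Sum>p\<in>I. (1 / real n) * (\<Sum>i<n. d ((T ^^ i) (u p)) ((T ^^ i) (v p)))) < \<epsilon>"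
    using order_tendstoD(2) assms(3) by fastforce
  then show ?thesis
    using eventually_gt_at_top[of 0]
  proof eventually_elim
    case (elim n)
    then have "(1 / real n) * (\<Sum>i<n. \<Sum>p\<in>I. d ((T ^^ i) (u p)) ((T ^^ i) (v p))) < \<epsilon>"
      by (subst sum.swap) (simp add: sum_distrib_left)
    with elim(2) show ?case by (simp add: field_simps)
  qed
qed

text \<open>If at every time some pair were at least \<open>\<epsilon>\<close> apart, then every
  summand over \<open>i\<close> in \<open>D_zero_avg_sum\<close> would be at least
  \<open>\<epsilon>\<close>, too much for its average.\<close>

lemma contract_finite:
  assumes "finite I" "\<And>p. p \<in> I \<Longrightarrow> u p \<in> M \<and> v p \<in> M \<and> D (u p) (v p) = 0" "\<epsilon> > 0"
  obtains i where "\<And>p. p \<in> I \<Longrightarrow> d ((T ^^ i) (u p)) ((T ^^ i) (v p)) < \<epsilon>"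
proof (rule ccontr)
  let ?s = "\<lambda>i. \<Sum>p\<in>I. d ((T ^^ i) (u p)) ((T ^^ i) (v p))"
  assume "\<not> thesis"
  then have *: "\<exists>p\<in>I. \<epsilon> \<le> d ((T ^^ i) (u p)) ((T ^^ i) (v p))" for i
    using that[of i] by (auto simp: not_le[symmetric])
  have "\<epsilon> \<le> ?s i" for i
  proof -
    obtain p where p: "p \<in> I" "\<epsilon> \<le> d ((T ^^ i) (u p)) ((T ^^ i) (v p))" using * by blast
    have "d ((T ^^ i) (u p)) ((T ^^ i) (v p)) \<le> ?s i"
      using member_le_sum[of p I "\<lambda>p. d ((T ^^ i) (u p)) ((T ^^ i) (v p))"] p(1) assms(1) by auto
    with p(2) show ?thesis by linarith
  qed
  then have le: "real n * \<epsilon> \<le> (\<Sum>i<n. ?s i)" for n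
    using sum_mono[of "{..<n}" "\<lambda>_. \<epsilon>" ?s] by simp
  obtain n where "(\<Sum>i<n. ?s i) < \<epsilon> * real n"
    using eventually_happens'[OF sequentially_bot D_zero_avg_sum[of I u v, OF assms]] by blast
  then show False using le[of n] by (simp add: mult.commute)
qed

section \<open>Small \<open>D\<close>-classes from a frequently stable point or from a finite
  class\<close>

text \<open>A finite Baire argument for \<open>D\<close>: if no \<open>Z j\<close> contained a
  \<open>D\<close>-ball, then shrinking a ball once for each \<open>j\<close> so as to leave the
  closed set \<open>Z j\<close> would produce a ball outside all of them, against the
  covering.\<close>

lemma finite_union_D_closed_interior:
  assumes "finite J" "M \<subseteq> (\<Union>j\<in>J. Z j)"
    and closed: "\<And>j v. j \<in> J \<Longrightarrow> v \<in> M \<Longrightarrow> (\<And>e. e > 0 \<Longrightarrow> \<exists>v'\<in>M. v' \<in> Z j \<and> D v' v < e) \<Longrightarrow> v \<in> Z j"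
  obtains j w r where "j \<in> J" "w \<in> M" "r > 0" "\<And>v. v \<in> M \<Longrightarrow> D v w < r \<Longrightarrow> v \<in> Z j"
proof (rule ccontr)
  note intro = that
  assume "\<not> thesis"
  then have *: "\<exists>v\<in>M. D v w < r \<and> v \<notin> Z j" if "j \<in> J" "w \<in> M" "r > 0" for j w r
    using that intro[of j w r] by blast
  have "\<exists>w'\<in>M. \<exists>r'>0. \<forall>v\<in>M. D v w' < r' \<longrightarrow> (\<forall>j\<in>J'. v \<notin> Z j)" if "J' \<subseteq> J" for J'
    using finite_subset[OF that assms(1)] that
  proof (induction J')
    case empty
    show ?case using nonempty by (auto intro: exI[of _ 1])
  next
    case (insert j J')
    then obtain w' r' where w': "w' \<in> M" "r' > 0" "\<And>v. v \<in> M \<Longrightarrow> D v w' < r' \<Longrightarrow> \<forall>j\<in>J'. v \<notin> Z j"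
      by auto
    obtain v where v: "v \<in> M" "D v w' < r'" "v \<notin> Z j"
      using *[of j w' r'] insert.prems w'(1,2) by auto
    have "\<not> (\<forall>e>0. \<exists>v'\<in>M. v' \<in> Z j \<and> D v' v < e)"
      using closed[of j v] insert.prems v by auto
    then obtain e where e: "e > 0" "\<And>v'. v' \<in> M \<Longrightarrow> v' \<in> Z j \<Longrightarrow> \<not> D v' v < e"
      by auto
    \<comment> \<open>The bound \<open>e\<close> avoids \<open>Z j\<close>, while
      \<open>r' - D v w'\<close> keeps the new ball inside the previous one.\<close>
    show ?case
    proof (intro bexI[of _ v] exI[of _ "min e (r' - D v w')"] conjI ballI impI)
      fix v' k assume v': "v' \<in> M" "D v' v < min e (r' - D v w')" "k \<in> insert j J'"
      have "D v' w' < r'" using D_triangle[of v' v w'] v' v(1) w'(1) by simp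
      then show "v' \<notin> Z k" using w'(3)[OF v'(1)] e(2)[OF v'(1)] v'(2,3) by auto
    qed (use v e in auto)
  qed
  then obtain w r where "w \<in> M" "r > 0" "\<forall>v\<in>M. D v w < r \<longrightarrow> (\<forall>j\<in>J. v \<notin> Z j)" by blast
  then show False using assms(2) by auto
qed

text \<open>By minimality finitely many \<open>T\<^sup>j B\<close> cover \<open>M\<close>, so the saturation of one of them, and hence that of
  \<open>B\<close>, has interior for \<open>D\<close>.\<close>

lemma ball_contains_D_ball_mod_D:
  assumes x: "x \<in> M" and "\<delta> > 0"
  obtains w r where "w \<in> M" "r > 0" "\<And>v. v \<in> M \<Longrightarrow> D v w < r \<Longrightarrow> \<exists>u\<in>mball x \<delta>. D u v = 0"
proof -
  obtain G where G: "\<And>z c. z \<in> M \<Longrightarrow> c \<in> M \<Longrightarrow> \<exists>n<G. d ((T ^^ n) z) c < \<delta> / 2"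
    using syndetic[of "\<delta> / 2"] \<open>\<delta> > 0\<close> by auto
  \<comment> \<open>\<open>Z j\<close> is the \<open>D\<close>-saturation of the
    \<open>T ^^ j\<close>-image of a closed ball, whose radius \<open>\<delta> / 2\<close> leaves
    limits of its points inside \<open>mball x \<delta>\<close>.\<close>
  define Z where "Z j = {v. \<exists>u\<in>M. d u x \<le> \<delta> / 2 \<and> D ((T ^^ j) u) v = 0}" for j
  have cover: "v \<in> (\<Union>j\<in>{..G}. Z j)" if v: "v \<in> M" for v
  proof -
    \<comment> \<open>From a \<open>G\<close>-th preimage \<open>z\<close> of \<open>v\<close>, the
      orbit meets the half ball at some time \<open>n < G\<close>, and the remaining
      \<open>G - n\<close> steps lead to \<open>v\<close>.\<close>
    obtain z where z: "z \<in> M" "(T ^^ G) z = v" using surj_funpow[OF v] .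
    then obtain n where n: "n < G" "d ((T ^^ n) z) x < \<delta> / 2" using G x by blast
    have "(T ^^ (G - n)) ((T ^^ n) z) = v"
      using n z by (simp add: funpow_funpow)
    then have "v \<in> Z (G - n)" unfolding Z_def using n(2) z(1) v by (intro CollectI bexI[of _ "(T ^^ n) z"]) auto
    then show ?thesis by auto
  qed
  have closed: "v \<in> Z j" if v: "v \<in> M" and ex: "\<And>e. e > 0 \<Longrightarrow> \<exists>v'\<in>M. v' \<in> Z j \<and> D v' v < e" for j v
  proof -
    have "\<exists>u\<in>M. d u x \<le> \<delta> / 2 \<and> D ((T ^^ j) u) v < 1 / real (Suc n)" for n
    proof -
      obtain v' where v': "v' \<in> M" "v' \<in> Z j" "D v' v < 1 / real (Suc n)"
        using ex[of "1 / real (Suc n)"] by auto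
      then obtain u where u: "u \<in> M" "d u x \<le> \<delta> / 2" "D ((T ^^ j) u) v' = 0" by (auto simp: Z_def)
      then show ?thesis using v' v D_triangle[of "(T ^^ j) u" v' v] by force
    qed
    then obtain u where u: "\<And>n. u n \<in> M" "\<And>n. d (u n) x \<le> \<delta> / 2"
      "\<And>n. D ((T ^^ j) (u n)) v < 1 / real (Suc n)" by metis
    \<comment> \<open>A limit point \<open>l\<close> of the \<open>u n\<close> witnesses
      \<open>v \<in> Z j\<close>: it stays in the closed ball, and the \<open>D\<close>-distances
      pass to the limit.\<close>
    obtain l s where l: "l \<in> M" "strict_mono s" "(\<lambda>n. d (u (s n)) l) \<longlonglongrightarrow> 0"
      using convergent_subseq[of u] u(1) by blast
    have "d l x \<le> \<delta> / 2 + d (u (s n)) l" for n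
      using triangle[of l "u (s n)" x] u(1,2)[of "s n"] l(1) x by (simp add: commute)
    then have "d l x \<le> \<delta> / 2 + 0"
      by (intro tendsto_lowerbound[OF tendsto_add[OF tendsto_const l(3)]] always_eventually) auto
    moreover have "D ((T ^^ j) l) v \<le> 0 + 0"
    proof (rule tendsto_lowerbound)
      show "(\<lambda>n. D (u (s n)) l + inverse (real (Suc (s n)))) \<longlonglongrightarrow> 0 + 0"
        using LIMSEQ_subseq_LIMSEQ[OF LIMSEQ_inverse_real_of_nat l(2)]
        by (intro tendsto_add D_tendsto u(1) l(1) l(3)) (simp add: o_def)
      have "D ((T ^^ j) l) v \<le> D (u (s n)) l + inverse (real (Suc (s n)))" for n
        using D_triangle[of "(T ^^ j) l" "(T ^^ j) (u (s n))" v] u(1) u(3)[of "s n"] l(1) v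
        by (simp add: D_funpow D_commute inverse_eq_divide)
      then show "\<forall>\<^sub>F n in sequentially. D ((T ^^ j) l) v \<le> D (u (s n)) l + inverse (real (Suc (s n)))"
        by simp
    qed simp
    ultimately have "d l x \<le> \<delta> / 2" "D ((T ^^ j) l) v = 0"
      using D_nonneg[of "(T ^^ j) l" v] l(1) v by auto
    then show ?thesis using l(1) unfolding Z_def by blast
  qed
  obtain j w' r where j: "w' \<in> M" "r > 0" "\<And>v. v \<in> M \<Longrightarrow> D v w' < r \<Longrightarrow> v \<in> Z j"
  proof (rule finite_union_D_closed_interior[of "{..G}" Z])
    show "M \<subseteq> (\<Union>j\<in>{..G}. Z j)" using cover by (rule subsetI)
    show "v \<in> Z j" if "v \<in> M" "\<And>e. e > 0 \<Longrightarrow> \<exists>v'\<in>M. v' \<in> Z j \<and> D v' v < e" for j v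
      using that by (rule closed)
  qed auto
  \<comment> \<open>Since \<open>T ^^ j\<close> preserves \<open>D\<close>, the ball found around
    \<open>w'\<close> pulls back to one of the same radius around a \<open>j\<close>-th
    preimage.\<close>
  obtain w where w: "w \<in> M" "(T ^^ j) w = w'" using surj_funpow[OF j(1)] .
  show thesis
  proof (rule that[OF w(1) j(2)])
    fix v assume v: "v \<in> M" "D v w < r"
    then have "(T ^^ j) v \<in> Z j" using j(3)[of "(T ^^ j) v"] w D_funpow[of v w j] by auto
    then obtain u where "u \<in> M" "d u x \<le> \<delta> / 2" "D u v = 0" by (auto simp: Z_def D_funpow v)
    then show "\<exists>u\<in>mball x \<delta>. D u v = 0"
      using x \<open>\<delta> > 0\<close> by (intro bexI[of _ u]) (auto simp: commute)
  qed
qed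

lemma mdiameter_le_iff:
  assumes "A \<subseteq> M" "A \<noteq> {}"
  shows "mdiameter d A \<le> e \<longleftrightarrow> (\<forall>u\<in>A. \<forall>v\<in>A. d u v \<le> e)"
proof -
  obtain K where "\<And>x y. x \<in> M \<Longrightarrow> y \<in> M \<Longrightarrow> d x y \<le> K" by (rule bounded_d) blast
  then have "bdd_above ((\<lambda>(x, y). d x y) ` (A \<times> A))" using assms(1) by (intro bdd_aboveI[of _ K]) auto
  then show ?thesis
    using assms(2) unfolding mdiameter_def by (simp add: cSUP_le_iff split_beta)
qed

text \<open>By contradiction: if every class contained two points \<open>\<epsilon>\<close> apart,
  each time outside the bad set \<open>F\<close> would contribute at least
  \<open>\<epsilon> / 8\<close> to sums whose averages tend to 0.\<close>

lemma frequently_stable_imp_small_classes: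
  assumes fs: "frequently_stable_point M d T x" and "\<epsilon> > 0"
  obtains y where "y \<in> M" "\<And>u v. u \<in> M \<Longrightarrow> v \<in> M \<Longrightarrow> D u y = 0 \<Longrightarrow> D v y = 0 \<Longrightarrow> d u v < \<epsilon>"
proof (rule ccontr)
  note intro = that
  assume "\<not> thesis"
  then have big: "\<exists>u\<in>M. \<exists>v\<in>M. D u y = 0 \<and> D v y = 0 \<and> d u v \<ge> \<epsilon>" if "y \<in> M" for y
    using intro[of y] that by (meson not_less)
  have x: "x \<in> M" using fs by (simp add: frequently_stable_point_def)
  obtain \<delta> where \<delta>: "\<delta> > 0" "upper_density {i. mdiameter d ((T ^^ i) ` mball x \<delta>) > \<epsilon> / 4} < 1"
    using fs \<open>\<epsilon> > 0\<close> unfolding frequently_stable_point_def by (metis divide_pos_pos zero_less_numeral)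
  define F where "F = {i. mdiameter d ((T ^^ i) ` mball x \<delta>) > \<epsilon> / 4}"
  obtain w r where w: "w \<in> M" "r > 0" "\<And>v. v \<in> M \<Longrightarrow> D v w < r \<Longrightarrow> \<exists>u\<in>mball x \<delta>. D u v = 0"
    by (rule ball_contains_D_ball_mod_D[OF x \<delta>(1)]) blast
  obtain \<rho>0 where \<rho>0: "\<rho>0 > 0" "\<And>x y. x \<in> M \<Longrightarrow> y \<in> M \<Longrightarrow> d x y < \<rho>0 \<Longrightarrow> D x y < r"
    by (rule D_small[OF w(2)]) blast
  \<comment> \<open>\<open>\<rho>0\<close> puts near hits into the \<open>D\<close>-ball of radius
    \<open>r\<close>; \<open>\<epsilon> / 8\<close> is one share of the final estimate.\<close>
  define \<rho> where "\<rho> = min \<rho>0 (\<epsilon> / 8)"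
  obtain G where G: "\<And>z c. z \<in> M \<Longrightarrow> c \<in> M \<Longrightarrow> \<exists>n<G. d ((T ^^ n) z) c < \<rho>"
    using syndetic[of \<rho>] \<rho>0(1) \<open>\<epsilon> > 0\<close> by (auto simp: \<rho>_def)
  obtain z where z: "z \<in> M" using nonempty by blast
  \<comment> \<open>\<open>H\<close> lists the times below \<open>G\<close> at which the orbit of
    \<open>z\<close> is in the \<open>D\<close>-ball around \<open>w\<close>; there
    \<open>u n\<close> will replace \<open>(T ^^ n) z\<close>.\<close>
  define H where "H = {n. n < G \<and> D ((T ^^ n) z) w < r}"
  have "finite H" by (simp add: H_def)
  have "\<exists>u. u \<in> mball x \<delta> \<and> D u ((T ^^ n) z) = 0" if "n \<in> H" for n
    using w(3)[OF funpow_in[OF z], of n] that unfolding H_def by blast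
  then have "\<exists>u. \<forall>n\<in>H. u n \<in> mball x \<delta> \<and> D (u n) ((T ^^ n) z) = 0"
    by (intro bchoice ballI)
  then obtain u where u: "\<And>n. n \<in> H \<Longrightarrow> u n \<in> mball x \<delta>" "\<And>n. n \<in> H \<Longrightarrow> D (u n) ((T ^^ n) z) = 0"
    by blast
  have uM: "u n \<in> M" if "n \<in> H" for n using u(1)[OF that] by auto
  let ?d = "\<lambda>i n. d ((T ^^ i) (u n)) ((T ^^ i) ((T ^^ n) z))"
  have key: "\<epsilon> / 8 \<le> (\<Sum>n\<in>H. ?d i n)" if "i \<notin> F" for i
  proof (rule ccontr)
    assume *: "\<not> ?thesis"
    have near: "?d i n < \<epsilon> / 8" if "n \<in> H" for n
      using * member_le_sum[of n H "?d i"] \<open>finite H\<close> that by auto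
    obtain p q where pq: "p \<in> M" "q \<in> M" "D p ((T ^^ i) w) = 0" "D q ((T ^^ i) w) = 0" "d p q \<ge> \<epsilon>"
      using big[of "(T ^^ i) w"] w(1) by auto
    \<comment> \<open>Every \<open>s\<close> in the class of \<open>(T ^^ i) w\<close> is nearly hit
      by the orbit of \<open>(T ^^ i) z\<close>. As \<open>T ^^ i\<close> preserves
      \<open>D\<close>, the hitting time belongs to \<open>H\<close>.\<close>
    have hit: "\<exists>n\<in>H. d ((T ^^ i) ((T ^^ n) z)) s < \<epsilon> / 8" if s: "s \<in> M" "D s ((T ^^ i) w) = 0" for s
    proof -
      obtain n where n: "n < G" "d ((T ^^ n) ((T ^^ i) z)) s < \<rho>" using G[of "(T ^^ i) z" s] z s(1) by auto
      have eq: "(T ^^ n) ((T ^^ i) z) = (T ^^ i) ((T ^^ n) z)" by (simp add: funpow_funpow add.commute)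
      have "D ((T ^^ n) z) w = D ((T ^^ i) ((T ^^ n) z)) ((T ^^ i) w)" using z w(1) by (simp add: D_funpow)
      also have "\<dots> \<le> D ((T ^^ i) ((T ^^ n) z)) s + D s ((T ^^ i) w)" using z w(1) s(1) by (intro D_triangle) auto
      also have "\<dots> < r" using n(2) \<rho>0(2)[of "(T ^^ i) ((T ^^ n) z)" s] z s unfolding eq \<rho>_def by simp
      finally have "n \<in> H" using n(1) by (simp add: H_def)
      then show ?thesis using n(2) unfolding eq \<rho>_def by auto
    qed
    obtain n where n: "n \<in> H" "d ((T ^^ i) ((T ^^ n) z)) p < \<epsilon> / 8" using hit pq by blast
    obtain m where m: "m \<in> H" "d ((T ^^ i) ((T ^^ m) z)) q < \<epsilon> / 8" using hit pq by blast
    have "mdiameter d ((T ^^ i) ` mball x \<delta>) \<le> \<epsilon> / 4" using that by (simp add: F_def)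
    then have "d ((T ^^ i) (u n)) ((T ^^ i) (u m)) \<le> \<epsilon> / 4"
      using u(1) n(1) m(1) x \<delta>(1) by (subst (asm) mdiameter_le_iff) (auto simp: mball_eq_empty)
    \<comment> \<open>The path from \<open>p\<close> to \<open>q\<close> passes an orbit point and
      its replacement at each end: four pieces below \<open>\<epsilon> / 8\<close> and one of at
      most \<open>\<epsilon> / 4\<close> add up to less than \<open>\<epsilon>\<close>.\<close>
    moreover have "d p q \<le> d p ((T ^^ i) ((T ^^ n) z)) + d ((T ^^ i) ((T ^^ n) z)) q"
      "d ((T ^^ i) ((T ^^ n) z)) q \<le> d ((T ^^ i) ((T ^^ n) z)) ((T ^^ i) (u n)) + d ((T ^^ i) (u n)) q"
      "d ((T ^^ i) (u n)) q \<le> d ((T ^^ i) (u n)) ((T ^^ i) (u m)) + d ((T ^^ i) (u m)) q"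
      "d ((T ^^ i) (u m)) q \<le> ?d i m + d ((T ^^ i) ((T ^^ m) z)) q"
      using pq z uM n(1) m(1) by (auto intro!: triangle)
    ultimately show False
      using near[OF n(1)] near[OF m(1)] n(2) m(2) pq(5) \<open>\<epsilon> > 0\<close>
        commute[of p "(T ^^ i) ((T ^^ n) z)"] commute[of "(T ^^ i) ((T ^^ n) z)" "(T ^^ i) (u n)"]
      by linarith
  qed
  \<comment> \<open>For large \<open>n\<close> at least \<open>(1 - c) * n\<close> of the times
    below \<open>n\<close> lie outside \<open>F\<close>. By \<open>key\<close> the sum is then at
    least \<open>(1 - c) * (\<epsilon> / 8) * n\<close>, against its eventual bound.\<close>
  obtain c where c: "upper_density F < ereal c" "ereal c < 1"
    using \<delta>(2) unfolding F_def using ereal_dense2 by blast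
  then have "c < 1" by simp
  have "\<forall>\<^sub>F n in sequentially. ereal (real (card (F \<inter> {..<n})) / real n) < ereal c"
    using c(1) unfolding upper_density_def by (rule Limsup_lessD)
  moreover have "\<forall>\<^sub>F n in sequentially. (\<Sum>i<n. \<Sum>n\<in>H. ?d i n) < (1 - c) * (\<epsilon> / 8) * real n"
    using \<open>finite H\<close> \<open>c < 1\<close> \<open>\<epsilon> > 0\<close> u(2) uM z by (intro D_zero_avg_sum) auto
  ultimately obtain n where n: "real (card (F \<inter> {..<n})) / real n < c"
    "(\<Sum>i<n. \<Sum>n\<in>H. ?d i n) < (1 - c) * (\<epsilon> / 8) * real n" "n > 0"
    using eventually_happens[OF eventually_conj[OF eventually_conj eventually_gt_at_top[of 0]]]
    by fastforce
  have "card {..<n} = card (F \<inter> {..<n}) + card ({..<n} - F)"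
    using card_Int_Diff[of "{..<n}" F] by (simp add: Int_commute)
  then have "(1 - c) * real n \<le> real (card ({..<n} - F))"
    using n(1,3) by (simp add: field_simps)
  then have "(1 - c) * real n * (\<epsilon> / 8) \<le> real (card ({..<n} - F)) * (\<epsilon> / 8)"
    using \<open>\<epsilon> > 0\<close> by (intro mult_right_mono) auto
  also have "\<dots> = (\<Sum>i\<in>{..<n} - F. \<epsilon> / 8)" by simp
  also have "\<dots> \<le> (\<Sum>i\<in>{..<n} - F. \<Sum>n\<in>H. ?d i n)" by (intro sum_mono key) auto
  also have "\<dots> \<le> (\<Sum>i<n. \<Sum>n\<in>H. ?d i n)" by (intro sum_mono2) (auto intro: sum_nonneg)
  finally show False using n(2) by (simp add: algebra_simps)
qed

text \<open>All pairs of the finite class are close at one common time \<open>i\<close>. As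
  \<open>T ^^ i\<close> is onto and preserves \<open>D\<close>, the class of
  \<open>(T ^^ i) x\<close> consists of the images of these points.\<close>

lemma finite_class_imp_small_classes:
  assumes x: "x \<in> M" and fin: "finite {u \<in> M. D u x = 0}" and "\<epsilon> > 0"
  obtains y where "y \<in> M" "\<And>u v. u \<in> M \<Longrightarrow> v \<in> M \<Longrightarrow> D u y = 0 \<Longrightarrow> D v y = 0 \<Longrightarrow> d u v < \<epsilon>"
proof -
  let ?E = "{u \<in> M. D u x = 0}"
  have "D u v = 0" if "u \<in> ?E" "v \<in> ?E" for u v
    using that D_triangle[of u x v] D_nonneg[of u v] x by (auto simp: D_commute)
  then have "fst p \<in> M \<and> snd p \<in> M \<and> D (fst p) (snd p) = 0" if "p \<in> ?E \<times> ?E" for p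
    using that by auto
  then obtain i where i: "\<And>p. p \<in> ?E \<times> ?E \<Longrightarrow> d ((T ^^ i) (fst p)) ((T ^^ i) (snd p)) < \<epsilon>"
    by (rule contract_finite[OF finite_cartesian_product[OF fin fin] _ \<open>\<epsilon> > 0\<close>]) blast+
  show thesis
  proof (rule that[of "(T ^^ i) x"])
    fix u v assume "u \<in> M" "v \<in> M" "D u ((T ^^ i) x) = 0" "D v ((T ^^ i) x) = 0"
    moreover obtain u' v' where "u' \<in> M" "(T ^^ i) u' = u" "v' \<in> M" "(T ^^ i) v' = v"
      using \<open>u \<in> M\<close> \<open>v \<in> M\<close> surj_funpow by metis
    ultimately show "d u v < \<epsilon>" using i[of "(u', v')"] x by (auto simp: D_funpow)
  qed (use x in auto)
qed

section \<open>Fibres of the maximal equicontinuous factor\<close>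

text \<open>The orbits come arbitrarily close at some times, equicontinuity keeps their images close
  from then on, and recurrence carries this back to the images of \<open>x\<close> and
  \<open>y\<close>.\<close>

lemma D_zero_imp_fibre:
  assumes eq: "equicontinuous_tds M' d' T'" and f: "factor_map M d T M' d' T' f"
    and xy: "x \<in> M" "y \<in> M" "D x y = 0"
  shows "f x = f y"
proof -
  interpret M': Metric_space M' d' using f by (simp add: factor_map_def tds_def)
  have fin: "f u \<in> M'" if "u \<in> M" for u using f that by (auto simp: factor_map_def)
  have cf: "continuous_map mtopology M'.mtopology f" using f by (simp add: factor_map_def)
  have fT: "f ((T ^^ n) u) = (T' ^^ n) (f u)" if "u \<in> M" for u n
    using f that by (induction n) (auto simp: factor_map_def)
  \<comment> \<open>\<open>?e\<close> is the factor metric pulled back to \<open>M\<close>;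
    \<open>E\<close> is equicontinuity for it with closeness measured by \<open>d\<close>.\<close>
  let ?e = "\<lambda>u v. d' (f u) (f v)"
  have E: "\<exists>\<delta>>0. \<forall>v\<in>M. d u v < \<delta> \<longrightarrow> (\<forall>n. ?e ((T ^^ n) u) ((T ^^ n) v) < \<epsilon>)"
    if u: "u \<in> M" and "\<epsilon> > 0" for u \<epsilon>
  proof -
    obtain \<delta>1 where \<delta>1: "\<delta>1 > 0" "\<forall>z\<in>M'. d' (f u) z < \<delta>1 \<longrightarrow> (\<forall>n. d' ((T' ^^ n) (f u)) ((T' ^^ n) z) < \<epsilon>)"
      using eq fin[OF u] \<open>\<epsilon> > 0\<close> unfolding equicontinuous_tds_def by meson
    obtain \<delta>2 where "\<delta>2 > 0" "\<forall>v. v \<in> M \<and> d u v < \<delta>2 \<longrightarrow> d' (f u) (f v) < \<delta>1"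
      using cf u \<delta>1(1) unfolding metric_continuous_map[OF M'.Metric_space_axioms] by meson
    then show ?thesis using \<delta>1(2) fin fT u by (intro exI[of _ \<delta>2]) simp
  qed
  have "\<exists>i. d ((T ^^ i) x) ((T ^^ i) y) < 1 / real (Suc n)" for n
    using contract_finite[of "{()}" "\<lambda>_. x" "\<lambda>_. y" "1 / real (Suc n)"] xy by auto
  then obtain i where i: "\<And>n. d ((T ^^ i n) x) ((T ^^ i n) y) < 1 / real (Suc n)" by metis
  obtain l s where l: "l \<in> M" "strict_mono s" "(\<lambda>n. d ((T ^^ i (s n)) x) l) \<longlonglongrightarrow> 0"
    by (rule convergent_subseq[of "\<lambda>n. (T ^^ i n) x", OF funpow_in[OF xy(1)]]) blast
  have "?e x y \<le> 0"
  proof (rule field_le_epsilon)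
    fix \<epsilon>' :: real assume "\<epsilon>' > 0"
    \<comment> \<open>One sixth for each step of the path \<open>x\<close>,
      \<open>(T ^^ N) x\<close>, \<open>(T ^^ k) l\<close>, \<open>(T ^^ N) y\<close>,
      \<open>(T ^^ (N + m)) x\<close>, \<open>(T ^^ m) x\<close>, \<open>y\<close>.\<close>
    define \<epsilon> where "\<epsilon> = \<epsilon>' / 6"
    have "\<epsilon> > 0" using \<open>\<epsilon>' > 0\<close> by (simp add: \<epsilon>_def)
    obtain \<delta>l where \<delta>l: "\<delta>l > 0" "\<And>v n. v \<in> M \<Longrightarrow> d l v < \<delta>l \<Longrightarrow> ?e ((T ^^ n) l) ((T ^^ n) v) < \<epsilon>"
      using E[OF l(1) \<open>\<epsilon> > 0\<close>] by blast
    obtain \<delta>x where \<delta>x: "\<delta>x > 0" "\<And>v n. v \<in> M \<Longrightarrow> d x v < \<delta>x \<Longrightarrow> ?e ((T ^^ n) x) ((T ^^ n) v) < \<epsilon>"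
      using E[OF xy(1) \<open>\<epsilon> > 0\<close>] by blast
    obtain \<delta>y where \<delta>y: "\<delta>y > 0" "\<And>v n. v \<in> M \<Longrightarrow> d y v < \<delta>y \<Longrightarrow> ?e ((T ^^ n) y) ((T ^^ n) v) < \<epsilon>"
      using E[OF xy(2) \<open>\<epsilon> > 0\<close>] by blast
    have "\<forall>\<^sub>F n in sequentially. d ((T ^^ i (s n)) x) l < \<delta>l / 2"
      using order_tendstoD(2)[OF l(3), of "\<delta>l / 2"] \<delta>l(1) by simp
    moreover have "\<forall>\<^sub>F n in sequentially. inverse (real (Suc n)) < \<delta>l / 2"
      using order_tendstoD(2)[OF LIMSEQ_inverse_real_of_nat, of "\<delta>l / 2"] \<delta>l(1) by simp
    ultimately have "\<forall>\<^sub>F n in sequentially. d ((T ^^ i (s n)) x) l < \<delta>l / 2 \<and> inverse (real (Suc n)) < \<delta>l / 2"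
      by (rule eventually_conj)
    then obtain n where n: "d ((T ^^ i (s n)) x) l < \<delta>l / 2" "inverse (real (Suc n)) < \<delta>l / 2"
      using eventually_happens'[OF sequentially_bot] by blast
    define j where "j = i (s n)"
    have "1 / real (Suc (s n)) \<le> 1 / real (Suc n)"
      using seq_suble[OF l(2), of n] by (simp add: frac_le)
    then have "d ((T ^^ j) x) ((T ^^ j) y) < \<delta>l / 2"
      using i[of "s n"] n(2) by (simp add: j_def inverse_eq_divide)
    moreover have jx: "d ((T ^^ j) x) l < \<delta>l / 2" using n(1) by (simp add: j_def)
    moreover have "d l ((T ^^ j) y) \<le> d l ((T ^^ j) x) + d ((T ^^ j) x) ((T ^^ j) y)"
      using l(1) xy by (intro triangle) auto
    ultimately have jl: "d l ((T ^^ j) x) < \<delta>l" "d l ((T ^^ j) y) < \<delta>l"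
      using \<delta>l(1) by (simp_all add: commute)
    \<comment> \<open>\<open>k\<close> brings \<open>x\<close> back near itself at time
      \<open>N = k + j\<close>. For \<open>y\<close> the return at time \<open>N\<close>, seen in
      the factor, is deduced from that of \<open>x\<close> through the nearby orbit point
      \<open>(T ^^ m) x\<close>.\<close>
    obtain k where k: "d ((T ^^ k) ((T ^^ j) x)) x < \<delta>x" by (rule orbit_dense[OF funpow_in[OF xy(1)] xy(1) \<delta>x(1)])
    obtain m where m: "d ((T ^^ m) x) y < \<delta>y" by (rule orbit_dense[OF xy(1,2) \<delta>y(1)])
    define N where "N = k + j"
    have N: "(T ^^ k) ((T ^^ j) u) = (T ^^ N) u" for u by (simp add: N_def funpow_funpow)
    have kx: "d x ((T ^^ N) x) < \<delta>x" using k unfolding N by (simp add: commute)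
    have my: "d y ((T ^^ m) x) < \<delta>y" using m by (simp add: commute)
    have "?e ((T ^^ k) l) ((T ^^ N) x) < \<epsilon>" "?e ((T ^^ k) l) ((T ^^ N) y) < \<epsilon>"
      using \<delta>l(2)[of "(T ^^ j) x" k] \<delta>l(2)[of "(T ^^ j) y" k] jl xy unfolding N by auto
    moreover have "?e x ((T ^^ N) x) < \<epsilon>" using \<delta>x(2)[of "(T ^^ N) x" 0] kx xy by simp
    moreover have "?e ((T ^^ N) y) ((T ^^ (N + m)) x) < \<epsilon>"
      using \<delta>y(2)[of "(T ^^ m) x" N] my xy by (simp add: funpow_funpow)
    moreover have "?e ((T ^^ m) x) ((T ^^ (N + m)) x) < \<epsilon>"
      using \<delta>x(2)[of "(T ^^ N) x" m] kx xy by (simp add: funpow_funpow add.commute)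
    moreover have "?e y ((T ^^ m) x) < \<epsilon>" using \<delta>y(2)[of "(T ^^ m) x" 0] my xy by simp
    moreover have "?e x y \<le> ?e x ((T ^^ N) x) + ?e ((T ^^ N) x) y"
      "?e ((T ^^ N) x) y \<le> ?e ((T ^^ N) x) ((T ^^ k) l) + ?e ((T ^^ k) l) y"
      "?e ((T ^^ k) l) y \<le> ?e ((T ^^ k) l) ((T ^^ N) y) + ?e ((T ^^ N) y) y"
      "?e ((T ^^ N) y) y \<le> ?e ((T ^^ N) y) ((T ^^ (N + m)) x) + ?e ((T ^^ (N + m)) x) y"
      "?e ((T ^^ (N + m)) x) y \<le> ?e ((T ^^ (N + m)) x) ((T ^^ m) x) + ?e ((T ^^ m) x) y"
      using xy l(1) fin by (auto intro!: M'.triangle)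
    ultimately show "?e x y \<le> 0 + \<epsilon>'"
      unfolding \<epsilon>_def
      using M'.commute[of "f ((T ^^ N) x)" "f ((T ^^ k) l)"]
        M'.commute[of "f ((T ^^ (N + m)) x)" "f ((T ^^ m) x)"] M'.commute[of "f ((T ^^ m) x)" "f y"]
      by linarith
  qed
  then show ?thesis using fin xy M'.zero M'.nonneg by (metis antisym)
qed

lemma D_diff: 
  assumes "a \<in> M" "b \<in> M" "a' \<in> M" "b' \<in> M"
  shows "\<bar>D a b - D a' b'\<bar> \<le> D a a' + D b b'"
proof -
  have "D a b \<le> D a a' + D a' b" "D a' b \<le> D a' b' + D b' b" "D a' b' \<le> D a' a + D a b'"
    "D a b' \<le> D a b + D b b'"
    using assms by (auto intro!: D_triangle)
  then show ?thesis using D_commute[of a a'] D_commute[of b b'] by linarith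
qed

text \<open>The displacement \<open>D (T\<^sup>n u) u\<close> is constant along orbits and continuous in \<open>u\<close>, hence by minimality
  independent of \<open>u\<close>; comparing it at \<open>x\<close> and at \<open>g x\<close> gives the claim for pairs on one orbit.\<close>

lemma D_endomorphism_isometric:
  assumes g: "\<And>u. u \<in> M \<Longrightarrow> g u \<in> M"
    and gT: "\<And>u. u \<in> M \<Longrightarrow> D (g (T u)) (T (g u)) = 0"
    and cont: "\<And>u \<epsilon>. u \<in> M \<Longrightarrow> \<epsilon> > 0 \<Longrightarrow> \<exists>\<delta>>0. \<forall>v\<in>M. d u v < \<delta> \<longrightarrow> D (g u) (g v) < \<epsilon>"
    and xy: "x \<in> M" "y \<in> M"
  shows "D (g x) (g y) = D x y"
proof -
  have gTn: "D (g ((T ^^ n) u)) ((T ^^ n) (g u)) = 0" if "u \<in> M" for u n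
  proof (induction n)
    case (Suc n)
    have "D (g (T ((T ^^ n) u))) (T ((T ^^ n) (g u)))
      \<le> D (g (T ((T ^^ n) u))) (T (g ((T ^^ n) u))) + D (T (g ((T ^^ n) u))) (T ((T ^^ n) (g u)))"
      using that g by (intro D_triangle) auto
    also have "\<dots> = 0" using gT[of "(T ^^ n) u"] D_T[of "g ((T ^^ n) u)" "(T ^^ n) (g u)"] Suc that g by simp
    finally show ?case
      using D_nonneg[of "g (T ((T ^^ n) u))" "T ((T ^^ n) (g u))"] by simp
  qed (use that g in simp)
  have move: "D ((T ^^ n) (g x)) (g x) = D ((T ^^ n) x) x" for n
  proof -
    have "\<bar>D ((T ^^ n) (g x)) (g x) - D ((T ^^ n) x) x\<bar> \<le> 0"
    proof (rule field_le_epsilon)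
      fix e :: real assume "e > 0"
      then have "e / 2 > 0" by simp
      then obtain \<delta> where \<delta>: "\<delta> > 0" "\<And>x y. x \<in> M \<Longrightarrow> y \<in> M \<Longrightarrow> d x y < \<delta> \<Longrightarrow> D x y < e / 2"
        by (rule D_small) blast
      obtain m where m: "d ((T ^^ m) x) (g x) < \<delta>" by (rule orbit_dense[OF xy(1) g[OF xy(1)] \<delta>(1)])
      have "D ((T ^^ m) x) (g x) < e / 2" using \<delta>(2) m xy g by auto
      moreover have "D ((T ^^ n) (g x)) ((T ^^ n) ((T ^^ m) x)) = D ((T ^^ m) x) (g x)"
        using xy g D_funpow[of "g x" "(T ^^ m) x" n] by (simp add: D_commute)
      moreover have "D ((T ^^ n) ((T ^^ m) x)) ((T ^^ m) x) = D ((T ^^ n) x) x"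
        using D_funpow[of "(T ^^ n) x" x m] xy by (simp add: funpow_funpow add.commute)
      moreover have "\<bar>D ((T ^^ n) (g x)) (g x) - D ((T ^^ n) ((T ^^ m) x)) ((T ^^ m) x)\<bar>
        \<le> D ((T ^^ n) (g x)) ((T ^^ n) ((T ^^ m) x)) + D (g x) ((T ^^ m) x)"
        using xy g by (intro D_diff) auto
      ultimately show "\<bar>D ((T ^^ n) (g x)) (g x) - D ((T ^^ n) x) x\<bar> \<le> 0 + e"
        using D_commute[of "g x" "(T ^^ m) x"] by linarith
    qed
    then show ?thesis by simp
  qed
  have "\<bar>D (g x) (g y) - D x y\<bar> \<le> 0"
  proof (rule field_le_epsilon)
    fix e :: real assume "e > 0"
    then have "e / 2 > 0" by simp
    then obtain \<delta> where \<delta>: "\<delta> > 0" "\<And>x y. x \<in> M \<Longrightarrow> y \<in> M \<Longrightarrow> d x y < \<delta> \<Longrightarrow> D x y < e / 2"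
      by (rule D_small) blast
    obtain \<delta>' where \<delta>': "\<delta>' > 0" "\<And>v. v \<in> M \<Longrightarrow> d y v < \<delta>' \<Longrightarrow> D (g y) (g v) < e / 2"
      using cont[OF xy(2) \<open>e / 2 > 0\<close>] by blast
    \<comment> \<open>The minimum serves the continuity of both \<open>D\<close> and
      \<open>g\<close> at \<open>y\<close>, which reduces the pair to \<open>x\<close> and a point
      of its orbit.\<close>
    obtain n where n: "d ((T ^^ n) x) y < min \<delta> \<delta>'"
      using orbit_dense[of x y "min \<delta> \<delta>'"] xy \<delta>(1) \<delta>'(1) by auto
    let ?u = "(T ^^ n) x"
    have u: "?u \<in> M" "D ?u y < e / 2" "D (g y) (g ?u) < e / 2"
      using n \<delta>(2)[of ?u y] \<delta>'(2)[of ?u] xy by (auto simp: commute)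
    have "D (g ?u) (g x) = D ((T ^^ n) (g x)) (g x)"
      using D_diff[of "g ?u" "g x" "(T ^^ n) (g x)" "g x"] gTn[of x n] xy g by simp
    then have "D (g ?u) (g x) = D ?u x" using move by simp
    moreover have "\<bar>D (g y) (g x) - D (g ?u) (g x)\<bar> \<le> D (g y) (g ?u) + D (g x) (g x)"
      "\<bar>D ?u x - D y x\<bar> \<le> D ?u y + D x x"
      by (rule D_diff; use xy g u in simp)+
    ultimately have "\<bar>D (g y) (g x) - D y x\<bar> \<le> e"
      using u(2,3) D_refl[OF xy(1)] D_refl[OF g[OF xy(1)]] by linarith
    then show "\<bar>D (g x) (g y) - D x y\<bar> \<le> 0 + e"
      using D_commute[of "g x" "g y"] D_commute[of x y] by simp
  qed
  then show ?thesis by simp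
qed

text \<open>The quotient of \<open>M\<close> by \<open>D = 0\<close> is realised on chosen
  representatives with \<open>D\<close> as metric. Its carrier inside \<open>M\<close> lets maps
  into it be treated as self-maps of \<open>M\<close> up to \<open>D\<close>.\<close>

lemma equicontinuous_quotient:
  obtains N S rep where "equicontinuous_tds N D S" "factor_map M d T N D S rep" "N \<subseteq> M"
    "\<And>u. u \<in> M \<Longrightarrow> S u = rep (T u)" "\<And>u. u \<in> M \<Longrightarrow> rep u \<in> M \<and> D (rep u) u = 0"
proof -
  define rep where "rep x = (SOME y. y \<in> M \<and> D y x = 0)" for x
  define N where "N = rep ` M"
  define S where "S u = rep (T u)" for u
  have rep: "rep x \<in> M \<and> D (rep x) x = 0" if "x \<in> M" for x
    unfolding rep_def by (rule someI[of _ x]) (use that in simp)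
  have D_rep: "D (rep x) (rep y) = D x y" if "x \<in> M" "y \<in> M" for x y
    using D_diff[of "rep x" "rep y" x y] rep that by simp
  have rep_eq: "rep x = rep y" if "x \<in> M" "y \<in> M" "D x y = 0" for x y
  proof -
    \<comment> \<open>For points at \<open>D\<close>-distance 0 the predicates under
      \<open>SOME\<close> coincide, so the same representative is chosen.\<close>
    have "D z x = 0 \<longleftrightarrow> D z y = 0" if "z \<in> M" for z
      using D_diff[of z x z y] \<open>D x y = 0\<close> \<open>x \<in> M\<close> \<open>y \<in> M\<close> that by simp
    then have "(z \<in> M \<and> D z x = 0) = (z \<in> M \<and> D z y = 0)" for z by blast
    then show ?thesis unfolding rep_def by simp
  qed
  have NM: "N \<subseteq> M" using rep by (auto simp: N_def)
  interpret N: Metric_space N D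
  proof
    show "D x y = 0 \<longleftrightarrow> x = y" if N: "x \<in> N" "y \<in> N" for x y
    proof
      assume "D x y = 0"
      moreover obtain a b where "a \<in> M" "x = rep a" "b \<in> M" "y = rep b" using N unfolding N_def by blast
      ultimately show "x = y" using rep_eq[of a b] D_rep[of a b] by simp
    qed (use N NM in auto)
    show "D x z \<le> D x y + D y z" if "x \<in> N" "y \<in> N" "z \<in> N" for x y z
      using that NM by (intro D_triangle) auto
  qed (simp, rule D_commute)
  have crep: "continuous_map mtopology N.mtopology rep"
    unfolding metric_continuous_map[OF N.Metric_space_axioms]
  proof (intro conjI ballI allI impI)
    fix a \<epsilon> assume "a \<in> M" "(0::real) < \<epsilon>"
    obtain \<delta> where "\<delta> > 0" "\<And>x y. x \<in> M \<Longrightarrow> y \<in> M \<Longrightarrow> d x y < \<delta> \<Longrightarrow> D x y < \<epsilon>"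
      by (rule D_small[OF \<open>0 < \<epsilon>\<close>]) blast
    then show "\<exists>\<delta>>0. \<forall>x. x \<in> M \<and> d a x < \<delta> \<longrightarrow> D (rep a) (rep x) < \<epsilon>"
      using \<open>a \<in> M\<close> D_rep by auto
  qed (auto simp: N_def)
  have SN: "S u \<in> N" if "u \<in> N" for u using that NM by (auto simp: N_def S_def)
  \<comment> \<open>The induced map is a \<open>D\<close>-isometry, which makes the quotient
    equicontinuous.\<close>
  have DS: "D (S u) (S v) = D u v" if "u \<in> N" "v \<in> N" for u v
    using subsetD[OF NM that(1)] subsetD[OF NM that(2)] by (simp add: S_def D_rep D_T)
  have cS: "continuous_map N.mtopology N.mtopology S"
    by (rule continuous_map_isometry[OF N.Metric_space_axioms N.Metric_space_axioms]) (use SN DS in auto)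
  have "compactin N.mtopology (rep ` M)"
    using image_compactin[OF _ crep] compact by (simp add: compact_space_def)
  then have "compact_space N.mtopology"
    by (simp only: compact_space_def N.topspace_mtopology N_def[symmetric])
  then have tN: "tds N D S"
    using cS nonempty N.Metric_space_axioms by (simp add: tds_def N_def)
  have DSn: "D ((S ^^ n) u) ((S ^^ n) v) = D u v" if "u \<in> N" "v \<in> N" for u v n
    by (induction n) (simp_all add: DS that tds_funpow_in[OF tN])
  have "equicontinuous_tds N D S"
    unfolding equicontinuous_tds_def using tN DSn by auto
  moreover have "rep (T u) = rep (T (rep u))" if "u \<in> M" for u
    using rep_eq[of "T u" "T (rep u)"] D_T[of u "rep u"] rep[OF that] that by (simp add: D_commute)
  then have "factor_map M d T N D S rep"
    unfolding factor_map_def using tds tN crep by (auto simp: N_def S_def)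
  ultimately show thesis by (rule that[OF _ _ NM S_def rep])
qed

text \<open>Maximality maps the factor onto the \<open>D\<close>-quotient, giving a self-map
  \<open>g\<close> of \<open>M\<close>, equivariant up to \<open>D\<close>, that is constant on
  fibres of \<open>f\<close>. It preserves \<open>D\<close> by
  \<open>D_endomorphism_isometric\<close>, so points of one fibre have \<open>D\<close>-distance
  0.\<close>

lemma fibre_iff_D_zero:
  assumes max: "maximal_equicontinuous_factor M d T M' d' T' f" and xy: "x \<in> M" "y \<in> M"
  shows "f x = f y \<longleftrightarrow> D x y = 0"
proof -
  note eqf = max[unfolded maximal_equicontinuous_factor_def, THEN conjunct1]
    and f = max[unfolded maximal_equicontinuous_factor_def, THEN conjunct2, THEN conjunct1]
  show ?thesis
  proof
    assume "f x = f y"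
    obtain N S rep where N: "equicontinuous_tds N D S" "factor_map M d T N D S rep" "N \<subseteq> M"
      "\<And>u. u \<in> M \<Longrightarrow> S u = rep (T u)" "\<And>u. u \<in> M \<Longrightarrow> rep u \<in> M \<and> D (rep u) u = 0"
      by (rule equicontinuous_quotient) blast
    interpret N: Metric_space N D using N(2) by (simp add: factor_map_def tds_def)
    obtain h where h: "factor_map M' d' T' N D S h"
      using maximal_equicontinuous_factor_any_type[OF max N(1,2)] by (elim exE)
    \<comment> \<open>Maximality gives \<open>h\<close> without the identity
      \<open>h \<circ> f = rep\<close>, so that \<open>g\<close> preserves \<open>D\<close> has to
      come from minimality.\<close>
    define g where "g = h \<circ> f"
    have cg: "continuous_map mtopology N.mtopology g"
      unfolding g_def using f h by (intro continuous_map_compose) (auto simp: factor_map_def)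
    have gN: "g u \<in> N" if "u \<in> M" for u
      using f h that by (auto simp: factor_map_def g_def)
    have gM: "g u \<in> M" if "u \<in> M" for u by (rule subsetD[OF N(3) gN[OF that]])
    have "D (g x) (g y) = D x y"
    proof (rule D_endomorphism_isometric[OF gM])
      show "D (g (T u)) (T (g u)) = 0" if "u \<in> M" for u
      proof -
        have "g (T u) = S (g u)" using f h that by (auto simp: factor_map_def g_def)
        then show ?thesis using N(4)[OF gM[OF that]] N(5)[OF T_in[OF gM[OF that]]] by simp
      qed
      show "\<exists>\<delta>>0. \<forall>v\<in>M. d u v < \<delta> \<longrightarrow> D (g u) (g v) < \<epsilon>" if "u \<in> M" "\<epsilon> > 0" for u \<epsilon>
        using bspec[OF conjunct2[OF cg[unfolded metric_continuous_map[OF N.Metric_space_axioms]]] that(1)]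
          that(2) by blast
    qed (assumption | rule xy)+
    moreover have "g x = g y" using \<open>f x = f y\<close> by (simp add: g_def)
    then have "D (g x) (g y) = 0" using D_refl[OF gM[OF xy(1)]] by simp
    ultimately show "D x y = 0" by simp
  next
    assume "D x y = 0"
    then show "f x = f y" by (rule D_zero_imp_fibre[OF eqf f xy])
  qed
qed

section \<open>From small fibres to an almost 1-1 factor map\<close>

text \<open>The complement is the image of the set \<open>K\<close> of points having a partner in
  their class at distance at least \<open>c\<close>. Both conditions pass to limits, so
  \<open>K\<close> is compact and its image closed.\<close>

lemma openin_small_fibres:
  assumes f: "factor_map M d T M' d' T' f"
    and fib: "\<And>x y. x \<in> M \<Longrightarrow> y \<in> M \<Longrightarrow> f x = f y \<longleftrightarrow> D x y = 0"
  shows "openin (Metric_space.mtopology M' d') {y \<in> M'. \<forall>u\<in>M. \<forall>v\<in>M. f u = y \<longrightarrow> f v = y \<longrightarrow> d u v < c}"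
    (is "openin _ ?V")
proof -
  interpret M': Metric_space M' d' using f by (simp add: factor_map_def tds_def)
  define K where "K = {u \<in> M. \<exists>v\<in>M. D u v = 0 \<and> c \<le> d u v}"
  have "compactin mtopology K"
    unfolding compactin_sequentially
  proof (intro conjI allI impI)
    fix \<sigma> :: "nat \<Rightarrow> 'a" assume "range \<sigma> \<subseteq> K"
    then have "\<forall>n. \<exists>v. \<sigma> n \<in> M \<and> v \<in> M \<and> D (\<sigma> n) v = 0 \<and> c \<le> d (\<sigma> n) v"
      by (auto simp: K_def)
    then obtain v where v: "\<And>n. \<sigma> n \<in> M" "\<And>n. v n \<in> M" "\<And>n. D (\<sigma> n) (v n) = 0" "\<And>n. c \<le> d (\<sigma> n) (v n)"
      by metis
    obtain l r where l: "l \<in> M" "strict_mono r" "(\<lambda>n. d (\<sigma> (r n)) l) \<longlonglongrightarrow> 0"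
      by (rule convergent_subseq[of \<sigma>, OF v(1)]) blast
    \<comment> \<open>This second extraction makes the partners converge too; the subsequence
      required for compactness is \<open>r\<close>.\<close>
    obtain l' s where l': "l' \<in> M" "strict_mono s" "(\<lambda>n. d (v (r (s n))) l') \<longlonglongrightarrow> 0"
      by (rule convergent_subseq[of "\<lambda>n. v (r n)", OF v(2)]) blast
    have ls: "(\<lambda>n. d (\<sigma> (r (s n))) l) \<longlonglongrightarrow> 0"
      using LIMSEQ_subseq_LIMSEQ[OF l(3) l'(2)] by (simp add: o_def)
    have "D l l' \<le> 0 + 0"
    proof (rule tendsto_lowerbound)
      show "(\<lambda>n. D (\<sigma> (r (s n))) l + D (v (r (s n))) l') \<longlonglongrightarrow> 0 + 0"
        by (intro tendsto_add D_tendsto v l l' ls)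
      show "\<forall>\<^sub>F n in sequentially. D l l' \<le> D (\<sigma> (r (s n))) l + D (v (r (s n))) l'"
      proof (intro always_eventually allI)
        fix n
        have "D l l' \<le> D l (\<sigma> (r (s n))) + D (\<sigma> (r (s n))) l'" using v l l' by (intro D_triangle)
        also have "D (\<sigma> (r (s n))) l' \<le> D (\<sigma> (r (s n))) (v (r (s n))) + D (v (r (s n))) l'"
          using v l l' by (intro D_triangle)
        finally show "D l l' \<le> D (\<sigma> (r (s n))) l + D (v (r (s n))) l'"
          using v(3) D_commute[of l] by simp
      qed
    qed simp
    then have "D l l' = 0" using D_nonneg[of l l'] by linarith
    moreover have "c \<le> d l l' + (0 + 0)"
    proof (rule tendsto_lowerbound)
      show "(\<lambda>n. d l l' + (d (\<sigma> (r (s n))) l + d (v (r (s n))) l')) \<longlonglongrightarrow> d l l' + (0 + 0)"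
        by (intro tendsto_intros ls l')
      show "\<forall>\<^sub>F n in sequentially. c \<le> d l l' + (d (\<sigma> (r (s n))) l + d (v (r (s n))) l')"
      proof (intro always_eventually allI)
        fix n
        have "c \<le> d (\<sigma> (r (s n))) (v (r (s n)))" by (rule v(4))
        also have "\<dots> \<le> d (\<sigma> (r (s n))) l + d l (v (r (s n)))" using v l l' by (intro triangle)
        also have "d l (v (r (s n))) \<le> d l l' + d l' (v (r (s n)))" using v l l' by (intro triangle)
        finally show "c \<le> d l l' + (d (\<sigma> (r (s n))) l + d (v (r (s n))) l')"
          using commute[of l'] by simp
      qed
    qed simp
    ultimately have "l \<in> K" using l(1) l'(1) unfolding K_def by auto
    then show "\<exists>l r. l \<in> K \<and> strict_mono r \<and> limitin mtopology (\<sigma> \<circ> r) l sequentially"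
      using l v(1) by (intro exI[of _ l] exI[of _ r]) (simp_all add: limitin_metric_dist_null o_def)
  qed (simp add: K_def)
  then have "compactin M'.mtopology (f ` K)"
    using f by (intro image_compactin) (auto simp: factor_map_def)
  then have "closedin M'.mtopology (f ` K)"
    by (rule compactin_imp_closedin[OF M'.Hausdorff_space_mtopology])
  then have "openin M'.mtopology (topspace M'.mtopology - f ` K)"
    by (rule openin_diff[OF openin_topspace])
  moreover have iff: "y \<in> f ` K \<longleftrightarrow> (\<exists>u\<in>M. \<exists>v\<in>M. f u = y \<and> f v = y \<and> c \<le> d u v)" for y
  proof
    assume "y \<in> f ` K"
    then obtain u v where "u \<in> M" "v \<in> M" "D u v = 0" "c \<le> d u v" "y = f u"
      unfolding K_def by blast
    then show "\<exists>u\<in>M. \<exists>v\<in>M. f u = y \<and> f v = y \<and> c \<le> d u v"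
      using fib[of u v] by (intro bexI[of _ u] bexI[of _ v]) simp_all
  next
    assume "\<exists>u\<in>M. \<exists>v\<in>M. f u = y \<and> f v = y \<and> c \<le> d u v"
    then obtain u v where "u \<in> M" "v \<in> M" "f u = y" "f v = y" "c \<le> d u v" by blast
    then show "y \<in> f ` K"
      using fib[of u v] unfolding K_def by (intro image_eqI[of _ _ u]) auto
  qed
  have "y \<notin> f ` K \<longleftrightarrow> (\<forall>u\<in>M. \<forall>v\<in>M. f u = y \<longrightarrow> f v = y \<longrightarrow> d u v < c)" for y
    unfolding iff by (meson not_le)
  then have "topspace M'.mtopology - f ` K = ?V"
    unfolding M'.topspace_mtopology set_diff_eq by simp
  ultimately show ?thesis by simp
qed

lemma small_classes_imp_almost_one_to_one:
  assumes f: "factor_map M d T M' d' T' f"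
    and fib: "\<And>x y. x \<in> M \<Longrightarrow> y \<in> M \<Longrightarrow> f x = f y \<longleftrightarrow> D x y = 0"
    and small: "\<And>\<epsilon>. \<epsilon> > 0 \<Longrightarrow>
      \<exists>y\<in>M. \<forall>u\<in>M. \<forall>v\<in>M. D u y = 0 \<longrightarrow> D v y = 0 \<longrightarrow> d u v < \<epsilon>"
  shows "almost_one_to_one M M' d' f"
proof -
  interpret M': Metric_space M' d' using f by (simp add: factor_map_def tds_def)
  have fM: "f ` M = M'" and cf: "continuous_map mtopology M'.mtopology f"
    and comp': "compact_space M'.mtopology"
    using f by (auto simp: factor_map_def tds_def)
  define V where "V c = {y \<in> M'. \<forall>u\<in>M. \<forall>v\<in>M. f u = y \<longrightarrow> f v = y \<longrightarrow> d u v < c}" for c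
  have op: "openin M'.mtopology (V c)" for c
    unfolding V_def by (rule openin_small_fibres[OF f fib])
  have dense: "M'.mtopology closure_of V c = M'" if "c > 0" for c
  proof -
    have near: "\<exists>y\<in>V c. d' (f x) y < \<eta>" if x: "x \<in> M" and "\<eta> > 0" for x \<eta>
    proof -
      obtain \<rho> where \<rho>: "\<rho> > 0" "\<And>z. z \<in> M \<Longrightarrow> d x z < \<rho> \<Longrightarrow> d' (f x) (f z) < \<eta>"
        using bspec[OF conjunct2[OF cf[unfolded metric_continuous_map[OF M'.Metric_space_axioms]]] x]
          \<open>\<eta> > 0\<close> by blast
      \<comment> \<open>The order of choice matters: first the hitting bound \<open>G\<close>, then
        \<open>\<delta>\<close> for all \<open>T ^^ k\<close> with \<open>k < G\<close>, then a
        class with distances below \<open>\<delta>\<close>, on which the hitting time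
        \<open>k\<close> depends.\<close>
      obtain G where G: "\<And>z c. z \<in> M \<Longrightarrow> c \<in> M \<Longrightarrow> \<exists>n<G. d ((T ^^ n) z) c < \<rho>"
        by (rule syndetic[OF \<rho>(1)]) blast
      obtain \<delta> where \<delta>: "\<delta> > 0"
        "\<And>k x y. k < G \<Longrightarrow> x \<in> M \<Longrightarrow> y \<in> M \<Longrightarrow> d x y < \<delta> \<Longrightarrow> d ((T ^^ k) x) ((T ^^ k) y) < c"
        by (rule uniform_funpow_less[OF \<open>c > 0\<close>, of G]) blast
      obtain y where y: "y \<in> M" "\<forall>u\<in>M. \<forall>v\<in>M. D u y = 0 \<longrightarrow> D v y = 0 \<longrightarrow> d u v < \<delta>"
        using small[OF \<delta>(1)] by blast
      obtain k where k: "k < G" "d ((T ^^ k) y) x < \<rho>" using G[OF y(1) x] by blast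
      have "f ((T ^^ k) y) \<in> V c"
        unfolding V_def
      proof (intro CollectI conjI ballI impI)
        fix u v assume uv: "u \<in> M" "v \<in> M" "f u = f ((T ^^ k) y)" "f v = f ((T ^^ k) y)"
        \<comment> \<open>Points in the fibre of \<open>f ((T ^^ k) y)\<close> come under
          \<open>T ^^ k\<close> from the class of \<open>y\<close>.\<close>
        obtain u' where u': "u' \<in> M" "(T ^^ k) u' = u" by (rule surj_funpow[OF uv(1)])
        obtain v' where v': "v' \<in> M" "(T ^^ k) v' = v" by (rule surj_funpow[OF uv(2)])
        have "D u ((T ^^ k) y) = 0" "D v ((T ^^ k) y) = 0"
          using fib[OF uv(1) funpow_in[OF y(1), of k]] fib[OF uv(2) funpow_in[OF y(1), of k]] uv(3,4)
          by simp_all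
        then have "D u' y = 0" "D v' y = 0"
          using D_funpow[OF u'(1) y(1), of k] D_funpow[OF v'(1) y(1), of k] u'(2) v'(2) by simp_all
        then have "d u' v' < \<delta>" using y(2) u' v' by blast
        then show "d u v < c" using \<delta>(2)[OF k(1) u'(1) v'(1)] u' v' by simp
      qed (use imageI[OF funpow_in[OF y(1)], of f k] fM in simp)
      moreover have "d' (f x) (f ((T ^^ k) y)) < \<eta>"
        using \<rho>(2)[OF funpow_in[OF y(1)], of k] k(2) commute[of x "(T ^^ k) y"] by simp
      ultimately show ?thesis by blast
    qed
    have "y \<in> M'.mtopology closure_of V c" if y: "y \<in> M'" for y
      unfolding M'.metric_closure_of
    proof (intro CollectI conjI allI impI y)
      fix r :: real assume "r > 0"
      obtain x where x: "x \<in> M" "f x = y" using y fM by blast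
      obtain z where "z \<in> V c" "d' y z < r" using near[OF x(1) \<open>r > 0\<close>] x(2) by blast
      then show "\<exists>z\<in>V c. z \<in> M'.mball y r"
        using y by (intro bexI[of _ z]) (simp_all add: V_def)
    qed
    then show ?thesis
      using closure_of_subset_topspace[of M'.mtopology "V c"] by auto
  qed
  \<comment> \<open>A fibre with distances below \<open>1 / (n + 1)\<close> for every
    \<open>n\<close> is a single point.\<close>
  define \<G> where "\<G> = range (\<lambda>n. V (inverse (real (Suc n))))"
  have G: "gdelta_in M'.mtopology (\<Inter>\<G>)"
    unfolding \<G>_def
  proof (rule gdelta_in_Inter)
    show "gdelta_in M'.mtopology S" if "S \<in> range (\<lambda>n. V (inverse (real (Suc n))))" for S
      using that open_imp_gdelta_in[OF op] by (elim rangeE) simp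
  qed simp_all
  have "M'.mtopology closure_of (\<Inter>\<G>) = M'"
  proof (rule M'.metric_Baire_category[OF M'.compact_space_imp_mcomplete[OF comp']])
    show "openin M'.mtopology S \<and> M'.mtopology closure_of S = M'" if "S \<in> \<G>" for S
      using that op dense unfolding \<G>_def by (elim rangeE) simp
  qed (simp add: \<G>_def)
  moreover have "\<Inter>\<G> \<subseteq> {y \<in> M'. card {x \<in> M. f x = y} = 1}"
  proof
    fix y assume y: "y \<in> \<Inter>\<G>"
    then have yV: "y \<in> V (inverse (real (Suc n)))" for n unfolding \<G>_def by blast
    then have yM: "y \<in> M'" unfolding V_def by blast
    then obtain x where x: "x \<in> M" "f x = y" using fM by blast
    have "u = x" if u: "u \<in> M" "f u = y" for u
    proof (rule ccontr)
      assume "u \<noteq> x"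
      then have "d u x > 0" using u x by simp
      then obtain n where "inverse (real (Suc n)) < d u x" using reals_Archimedean by blast
      moreover have "d u x < inverse (real (Suc n))" using yV[of n] u x unfolding V_def by blast
      ultimately show False by simp
    qed
    then have "{x \<in> M. f x = y} = {x}" using x by blast
    then show "y \<in> {y \<in> M'. card {x \<in> M. f x = y} = 1}" using yM by simp
  qed
  ultimately show ?thesis
    unfolding almost_one_to_one_def residual_in_def M'.topspace_mtopology
    by (intro conjI exI[of _ "\<Inter>\<G>"] G) (auto)
qed

section \<open>From a singleton class to frequent stability\<close>

text \<open>Near \<open>x0\<close> small \<open>D\<close> forces small \<open>d\<close>. The orbit
  of \<open>x\<close> returns close to \<open>x0\<close> with bounded gaps, and at these times the
  whole image of a ball is \<open>D\<close>-close to \<open>x0\<close>, hence of small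
  diameter.\<close>

lemma singleton_class_imp_frequently_stable:
  assumes x0: "x0 \<in> M" and single: "\<And>u. u \<in> M \<Longrightarrow> D u x0 = 0 \<Longrightarrow> u = x0" and x: "x \<in> M"
  shows "frequently_stable_point M d T x"
  unfolding frequently_stable_point_def
proof (intro conjI allI impI)
  fix \<epsilon> :: real assume "\<epsilon> > 0"
  \<comment> \<open>Otherwise points tending to \<open>x0\<close> in \<open>D\<close> but staying
    \<open>\<epsilon> / 2\<close> away in \<open>d\<close> would accumulate at another point of its
    class.\<close>
  obtain \<eta> where \<eta>: "\<eta> > 0" "\<And>u. u \<in> M \<Longrightarrow> D u x0 < \<eta> \<Longrightarrow> d u x0 < \<epsilon> / 2"
  proof (rule ccontr)
    note intro = that
    assume "\<not> thesis"
    then have "\<exists>u. u \<in> M \<and> D u x0 < inverse (real (Suc n)) \<and> d u x0 \<ge> \<epsilon> / 2" for n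
      using intro[of "inverse (real (Suc n))"] by (auto simp: not_less[symmetric])
    then obtain u where u: "\<And>n. u n \<in> M" "\<And>n. D (u n) x0 < inverse (real (Suc n))" "\<And>n. d (u n) x0 \<ge> \<epsilon> / 2"
      by metis
    obtain l s where l: "l \<in> M" "strict_mono s" "(\<lambda>n. d (u (s n)) l) \<longlonglongrightarrow> 0"
      by (rule convergent_subseq[of u, OF u(1)]) blast
    have "D l x0 \<le> 0 + 0"
    proof (rule tendsto_lowerbound)
      show "(\<lambda>n. D (u (s n)) l + inverse (real (Suc (s n)))) \<longlonglongrightarrow> 0 + 0"
        using LIMSEQ_subseq_LIMSEQ[OF LIMSEQ_inverse_real_of_nat l(2)]
        by (intro tendsto_add D_tendsto u(1) l(1) l(3)) (simp add: o_def)
      have "D l x0 \<le> D (u (s n)) l + inverse (real (Suc (s n)))" for n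
        using D_triangle[of l "u (s n)" x0] u(1)[of "s n"] u(2)[of "s n"] l(1) x0 D_commute[of l] by simp
      then show "\<forall>\<^sub>F n in sequentially. D l x0 \<le> D (u (s n)) l + inverse (real (Suc (s n)))"
        by simp
    qed simp
    then have "D l x0 = 0" using D_nonneg[of l x0] by linarith
    then have "l = x0" by (rule single[OF l(1)])
    have "\<forall>\<^sub>F n in sequentially. d (u (s n)) l < \<epsilon> / 2"
      using order_tendstoD(2)[OF l(3), of "\<epsilon> / 2"] \<open>\<epsilon> > 0\<close> by simp
    then obtain n where "d (u (s n)) l < \<epsilon> / 2"
      using eventually_happens'[OF sequentially_bot] by blast
    with u(3)[of "s n"] \<open>l = x0\<close> show False by simp
  qed
  have "\<eta> / 2 > 0" using \<eta>(1) by simp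
  \<comment> \<open>The same \<open>\<delta>\<close> is the radius of the ball and the accuracy of
    the returns; each contributes less than \<open>\<eta> / 2\<close> in \<open>D\<close>.\<close>
  obtain \<delta> where \<delta>: "\<delta> > 0" "\<And>x y. x \<in> M \<Longrightarrow> y \<in> M \<Longrightarrow> d x y < \<delta> \<Longrightarrow> D x y < \<eta> / 2"
    by (rule D_small[OF \<open>\<eta> / 2 > 0\<close>]) blast
  obtain G where G: "\<And>z c. z \<in> M \<Longrightarrow> c \<in> M \<Longrightarrow> \<exists>n<G. d ((T ^^ n) z) c < \<delta>"
    by (rule syndetic[OF \<delta>(1)]) blast
  have "\<exists>k<G. n + k \<notin> {i. mdiameter d ((T ^^ i) ` mball x \<delta>) > \<epsilon>}" for n
  proof -
    obtain k where k: "k < G" "d ((T ^^ k) ((T ^^ n) x)) x0 < \<delta>" using G[OF funpow_in[OF x] x0] by blast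
    let ?i = "n + k"
    have i: "D ((T ^^ ?i) x) x0 < \<eta> / 2"
      using \<delta>(2)[of "(T ^^ ?i) x" x0] k(2) x x0 by (simp add: funpow_funpow add.commute)
    have near: "d ((T ^^ ?i) u) x0 < \<epsilon> / 2" if u: "u \<in> M" "d x u < \<delta>" for u
    proof (rule \<eta>(2))
      have "D ((T ^^ ?i) u) x0 \<le> D ((T ^^ ?i) u) ((T ^^ ?i) x) + D ((T ^^ ?i) x) x0"
        using u x x0 by (intro D_triangle) auto
      also have "D ((T ^^ ?i) u) ((T ^^ ?i) x) = D x u" using u x D_funpow[of u x ?i] D_commute[of u x] by simp
      also have "D x u < \<eta> / 2" using u x by (intro \<delta>(2))
      finally show "D ((T ^^ ?i) u) x0 < \<eta>" using i by simp
    qed (use u in simp)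
    have "mdiameter d ((T ^^ ?i) ` mball x \<delta>) \<le> \<epsilon>"
    proof (subst mdiameter_le_iff)
      show "(T ^^ ?i) ` mball x \<delta> \<noteq> {}" using x \<delta>(1) by (simp add: mball_eq_empty)
      show "\<forall>a\<in>(T ^^ ?i) ` mball x \<delta>. \<forall>b\<in>(T ^^ ?i) ` mball x \<delta>. d a b \<le> \<epsilon>"
      proof (intro ballI)
        fix a b assume "a \<in> (T ^^ ?i) ` mball x \<delta>" "b \<in> (T ^^ ?i) ` mball x \<delta>"
        then have "a \<in> M" "b \<in> M" "d a x0 < \<epsilon> / 2" "d b x0 < \<epsilon> / 2" using near by auto
        then show "d a b \<le> \<epsilon>" using triangle[of a x0 b] x0 commute[of x0 b] by simp
      qed
    qed auto
    then show ?thesis using k(1) by (intro exI[of _ k]) simp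
  qed
  then have "upper_density {i. mdiameter d ((T ^^ i) ` mball x \<delta>) > \<epsilon>} < 1"
    by (rule upper_density_less_1_if_gaps)
  then show "\<exists>\<delta>>0. upper_density {i. mdiameter d ((T ^^ i) ` mball x \<delta>) > \<epsilon>} < 1"
    using \<delta>(1) by blast
qed (rule x)

end

section \<open>The equivalence, with all implications routed through almost 1-1\<close>

theorem theorem3p6:
  fixes M :: "'a set" and d :: "'a \<Rightarrow> 'a \<Rightarrow> real" and T :: "'a \<Rightarrow> 'a"
    and Meq :: "'b set" and deq :: "'b \<Rightarrow> 'b \<Rightarrow> real" and Teq :: "'b \<Rightarrow> 'b"
    and \<pi>eq :: "'a \<Rightarrow> 'b"
  assumes "minimal_tds M d T"
    and "mean_equicontinuous M d T"
    and "maximal_equicontinuous_factor M d T Meq deq Teq \<pi>eq"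
  shows "(almost_one_to_one M Meq deq \<pi>eq \<longleftrightarrow> (\<forall>x\<in>M. frequently_stable_point M d T x))
    \<and> ((\<forall>x\<in>M. frequently_stable_point M d T x) \<longleftrightarrow> (\<exists>x\<in>M. frequently_stable_point M d T x))
    \<and> ((\<exists>x\<in>M. frequently_stable_point M d T x) \<longleftrightarrow> almost_finite_to_one M Meq deq \<pi>eq)"
proof -
  interpret minimal_mean_equicontinuous M d T
    using assms(1,2) by (auto simp: minimal_mean_equicontinuous_def
        minimal_mean_equicontinuous_axioms_def minimal_tds_def tds_def)
  note f = assms(3)[unfolded maximal_equicontinuous_factor_def, THEN conjunct2, THEN conjunct1]
  note fib = fibre_iff_D_zero[OF assms(3)]
  have fM: "\<pi>eq ` M = Meq" and "Metric_space Meq deq" "Meq \<noteq> {}"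
    using f by (simp_all add: factor_map_def tds_def)
  interpret Meq: Metric_space Meq deq by fact
  \<comment> \<open>A dense subset of the nonempty \<open>Meq\<close> is nonempty, and a single
    fibre over it starts each argument below.\<close>
  have residual_nonempty: "\<exists>x\<in>M. \<pi>eq x \<in> A" if "residual_in Meq.mtopology A" for A
  proof -
    have "A \<subseteq> Meq" "A \<noteq> {}"
      using that \<open>Meq \<noteq> {}\<close> by (auto simp: residual_in_def)
    then show ?thesis using fM by blast
  qed
  have to_all: "\<forall>x\<in>M. frequently_stable_point M d T x" if a: "almost_one_to_one M Meq deq \<pi>eq"
  proof -
    obtain x where x: "x \<in> M" "card {u \<in> M. \<pi>eq u = \<pi>eq x} = 1"
      using residual_nonempty[OF a[unfolded almost_one_to_one_def]] by blast
    then obtain x0 where x0: "{u \<in> M. \<pi>eq u = \<pi>eq x} = {x0}" by (rule_tac card_1_singletonE)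
    then have "x = x0" using x(1) by blast
    then have "u = x" if "u \<in> M" "D u x = 0" for u
      using x0 that fib[OF that(1) x(1)] by blast
    then show ?thesis using singleton_class_imp_frequently_stable[OF x(1)] by blast
  qed
  have small: "almost_one_to_one M Meq deq \<pi>eq"
    if "\<And>\<epsilon>. \<epsilon> > 0 \<Longrightarrow> \<exists>y\<in>M. \<forall>u\<in>M. \<forall>v\<in>M. D u y = 0 \<longrightarrow> D v y = 0 \<longrightarrow> d u v < \<epsilon>"
    by (rule small_classes_imp_almost_one_to_one[OF f fib that])
  have from_ex: "almost_one_to_one M Meq deq \<pi>eq" if "\<exists>x\<in>M. frequently_stable_point M d T x"
  proof (rule small)
    fix \<epsilon> :: real assume "\<epsilon> > 0"
    obtain x where "frequently_stable_point M d T x" using \<open>\<exists>x\<in>M. _\<close> by blast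
    then obtain y where "y \<in> M" "\<And>u v. u \<in> M \<Longrightarrow> v \<in> M \<Longrightarrow> D u y = 0 \<Longrightarrow> D v y = 0 \<Longrightarrow> d u v < \<epsilon>"
      by (rule frequently_stable_imp_small_classes[OF _ \<open>\<epsilon> > 0\<close>]) blast
    then show "\<exists>y\<in>M. \<forall>u\<in>M. \<forall>v\<in>M. D u y = 0 \<longrightarrow> D v y = 0 \<longrightarrow> d u v < \<epsilon>" by blast
  qed
  have from_finite: "almost_one_to_one M Meq deq \<pi>eq" if a: "almost_finite_to_one M Meq deq \<pi>eq"
  proof (rule small)
    fix \<epsilon> :: real assume "\<epsilon> > 0"
    obtain x where x: "x \<in> M" "finite {u \<in> M. \<pi>eq u = \<pi>eq x}"
      using residual_nonempty[OF a[unfolded almost_finite_to_one_def]] by blast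
    moreover have "{u \<in> M. \<pi>eq u = \<pi>eq x} = {u \<in> M. D u x = 0}" using fib[OF _ x(1)] by blast
    ultimately have "finite {u \<in> M. D u x = 0}" by simp
    then obtain y where "y \<in> M" "\<And>u v. u \<in> M \<Longrightarrow> v \<in> M \<Longrightarrow> D u y = 0 \<Longrightarrow> D v y = 0 \<Longrightarrow> d u v < \<epsilon>"
      by (rule finite_class_imp_small_classes[OF x(1) _ \<open>\<epsilon> > 0\<close>]) blast
    then show "\<exists>y\<in>M. \<forall>u\<in>M. \<forall>v\<in>M. D u y = 0 \<longrightarrow> D v y = 0 \<longrightarrow> d u v < \<epsilon>" by blast
  qed
  have to_finite: "almost_finite_to_one M Meq deq \<pi>eq" if "almost_one_to_one M Meq deq \<pi>eq"
  proof -
    \<comment> \<open>Infinite sets have \<open>card\<close> 0, so \<open>card = 1\<close> forces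
      finiteness.\<close>
    have "{y \<in> Meq. card {x \<in> M. \<pi>eq x = y} = 1} \<subseteq> {y \<in> Meq. finite {x \<in> M. \<pi>eq x = y}}"
      by (auto intro: card_ge_0_finite)
    moreover have "{y \<in> Meq. finite {x \<in> M. \<pi>eq x = y}} \<subseteq> topspace Meq.mtopology"
      by auto
    ultimately show ?thesis
      using that unfolding almost_one_to_one_def almost_finite_to_one_def residual_in_def by blast
  qed
  \<comment> \<open>(i) to (ii) to (iii) to (i) is a cycle, whose middle step uses that
    \<open>M\<close> is nonempty; (iv) is tied to (i) in both directions.\<close>
  show ?thesis
    using to_all from_ex from_finite to_finite nonempty by blast
qed

end
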